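(* Let $K$ be a field, let $m\geq 1$ be an integer, and let $n\geq 2$ be an integer. Let $p(x_1,\ldots,x_m)$ be a nonzero multilinear polynomial in non-commutative variables over $K$. Suppose that $|K|>\frac{n(n-1)}{3}$. Then $p(UT_n)=UT_n^{(t)}$ for some integer $t$ with $-1\leq t\leq \frac{m}{2}-1$.
   Context: A multilinear polynomial $p(x_1,\ldots,x_m)$ is an element of the free associative algebra over $K$ on non-commuting variables of the form $\sum_{\sigma\in S_m}\lambda_\sigma x_{\sigma(1)}\cdots x_{\sigma(m)}$ with $\lambda_\sigma\in K$. $UT_n$ is the algebra of all $n\times n$ upper triangular matrices over $K$. For $t\geq 0$, $UT_n^{(t)}$ is the set of all matrices in $UT_n$ whose $(i,j)$ entries are zero whenever $j-i\leq t$ (so it is $\{0\}$ if $t\geq n-1$), and $UT_n^{(-1)}=UT_n$. $p(UT_n)=\{p(u_1,\ldots,u_m) : u_1,\ldots,u_m\in UT_n\}$ is the image of $p$ on $UT_n$. *)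

theory Defs
  imports "HOL-Library.Poly_Mapping" "HOL-Combinatorics.Permutations" "Jordan_Normal_Form.Matrix"
begin

(* The free monoid on variables x_0, x_1, ..., written additively because the
   convolution product on finitely supported functions is defined over
   an additive monoid of exponents. *)
datatype free_word = Word (letters: "nat list")

instantiation free_word :: monoid_add
begin

definition zero_free_word :: free_word
  where "0 = Word []"

definition plus_free_word :: "free_word \<Rightarrow> free_word \<Rightarrow> free_word"
  where "v + w = Word (letters v @ letters w)"

instance
  by standard (simp_all add: zero_free_word_def plus_free_word_def)

end

(* The free associative algebra, as the monoid algebra of the free monoid. *)
type_synonym 'a free_alg = "free_word \<Rightarrow>\<^sub>0 'a"

definition var :: "nat \<Rightarrow> 'a::field free_alg"
  where "var i = Poly_Mapping.single (Word [i]) 1"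

definition const :: "'a::field \<Rightarrow> 'a free_alg"
  where "const c = Poly_Mapping.single 0 c"

definition multilinear :: "nat \<Rightarrow> 'a::field free_alg \<Rightarrow> bool"
  where "multilinear m p \<longleftrightarrow>
    (\<exists>c :: (nat \<Rightarrow> nat) \<Rightarrow> 'a.
       p = (\<Sum>\<sigma> | \<sigma> permutes {1..m}. const (c \<sigma>) * (\<Prod>i\<leftarrow>[1..<Suc m]. var (\<sigma> i))))"

definition word_eval :: "nat \<Rightarrow> (nat \<Rightarrow> 'a::field mat) \<Rightarrow> free_word \<Rightarrow> 'a mat"
  where "word_eval n u w = foldr (\<lambda>i A. u i * A) (letters w) (1\<^sub>m n)"

(* The sum over the support is taken entrywise, since the matrix type has no fixed
   dimension and hence no zero element. *)
definition poly_eval :: "nat \<Rightarrow> (nat \<Rightarrow> 'a::field mat) \<Rightarrow> 'a free_alg \<Rightarrow> 'a mat"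
  where "poly_eval n u p =
    mat n n (\<lambda>(i, j). \<Sum>w\<in>Poly_Mapping.keys p. Poly_Mapping.lookup p w * word_eval n u w $$ (i, j))"

definition UT :: "nat \<Rightarrow> 'a::field mat set"
  where "UT n = {A \<in> carrier_mat n n. upper_triangular A}"

(* Integer differences: truncated subtraction on nat would lose the case t = -1. *)
definition UT_level :: "nat \<Rightarrow> int \<Rightarrow> 'a::field mat set"
  where "UT_level n t =
    {A \<in> UT n. \<forall>i<n. \<forall>j<n. int j - int i \<le> t \<longrightarrow> A $$ (i, j) = 0}"

definition UT_image :: "nat \<Rightarrow> nat \<Rightarrow> 'a::field free_alg \<Rightarrow> 'a mat set"
  where "UT_image n m p = {poly_eval n u p | u. \<forall>i\<in>{1..m}. u i \<in> UT n}"

lemma UT_level_minus_one: "UT_level n (-1) = UT n"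
  by (auto simp: UT_level_def UT_def upper_triangular_def)

end

theory Submission imports Defs begin

text \<open>
  A multilinear \<open>p\<close> is determined by its values on matrix units: replacing each variable \<open>l\<close> by
  \<open>e\<^bsub>f l, g l\<^esub>\<close>, the \<open>(i, j)\<close> entry of \<open>p\<close> is the sum of the coefficients of those words along which
  the units compose to a route from \<open>i\<close> to \<open>j\<close>. For upper triangular units a variable is either a loop
  (\<open>f l = g l\<close>) or a jump (\<open>f l < g l\<close>). Let \<open>r\<close> (\<open>jump_rank\<close>) be the least number of jumps in a choice
  of units on which \<open>p\<close> does not vanish; the theorem holds with \<open>t = r - 1\<close>.

  The image lies in \<open>UT\<^sub>n\<^bsup>(r-1)\<^esup>\<close> because a route with at least \<open>r\<close> jumps ends at least \<open>r\<close> steps above its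
  start (\<open>form_entry_nonzero_imp_distance\<close>). Moreover \<open>2r \<le> m\<close>: given a word with nonzero coefficient, let its
  letters be alternately loops and jumps. Each vertex then carries at most one loop, so no other word follows
  this route and \<open>p\<close> takes the coefficient of the word as its value (\<open>jump_rank_le_half\<close>).

  Conversely, every matrix of \<open>UT\<^sub>n\<^bsup>(r-1)\<^esup>\<close> is attained. If \<open>r = 0\<close> the sum of the coefficients is nonzero and all variables
  but one can be replaced by the identity. If \<open>r > 0\<close>, a nonvanishing choice of units with \<open>r\<close> jumps can be
  relabelled so that its jumps are \<open>0 \<rightarrow> 1 \<rightarrow> \<dots> \<rightarrow> r\<close> (\<open>canonical_route\<close>). Let \<open>k\<close> be the variable of the first
  jump. Substitute bidiagonal matrices for the variables of the other jumps, diagonal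
  matrices for the variables of the loops, and a strictly upper triangular unknown \<open>N\<close> for \<open>k\<close>. By
  minimality of \<open>r\<close> a route contributes only if all \<open>r\<close> variables jump, so \<open>N\<^bsub>a,b\<^esub>\<close> occurs in the \<open>(i, j)\<close> entry
  only if \<open>a \<ge> i\<close> and \<open>j - i = (b - a) + (r - 1)\<close> (\<open>bidiagonal_away_support\<close>). Hence the linear map from \<open>N\<close>
  to the value of \<open>p\<close> is triangular with respect to the rows, with pivots the coefficients of
  \<open>N\<^bsub>i,j-r+1\<^esub>\<close> in the \<open>(i, j)\<close> entry, and it is onto \<open>UT\<^sub>n\<^bsup>(r-1)\<^esup>\<close> once all pivots are nonzero (\<open>form_entry_surjective\<close>).

  As a function of the chosen matrix entries, each pivot is affine in every single entry and
  not identically zero, as a suitably placed canonical route shows. Such functions have a common nonzero as soon as each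
  entry occurs in fewer than \<open>|K|\<close> of them (\<open>common_nonzero_point\<close>). The pivot at \<open>(i, j)\<close> involves only rows in
  \<open>{i} \<union> {j-r+1..j}\<close>, so an entry occurs in at most \<open>r(n-r)\<close> pivots (\<open>card_positions_meeting\<close>), and
  \<open>3r(n-r) \<le> n(n-1)\<close> unless \<open>n = 2\<close>. This is where the bound on \<open>|K|\<close> enters.
\<close>

section \<open>Simultaneous non-vanishing of multi-affine functions\<close>

text \<open>
  The variables are given values one at a time, keeping every \<open>P t\<close> not identically zero in the
  remaining ones. For the variable \<open>v\<close>, a function \<open>P t = \<alpha> + v\<beta>\<close> excludes at most one value, since two excluded
  values would force \<open>\<alpha> = \<beta> = 0\<close>; and it excludes none if it does not depend on \<open>v\<close>. So the number of
  excluded values is at most the number of functions depending on \<open>v\<close>. The point \<open>x0\<close> fixes the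
  values outside the finite set \<open>X\<close> of variables, which is what makes the induction over \<open>X\<close> work.
\<close>

lemma common_nonzero_point:
  fixes P :: "'t \<Rightarrow> ('v \<Rightarrow> 'a::field) \<Rightarrow> 'a"
  assumes "finite X" and "finite T"
    and affine: "\<And>t v x. \<lbrakk>t \<in> T; v \<in> X\<rbrakk> \<Longrightarrow> \<exists>\<beta>. \<forall>a. P t (x(v := a)) = P t (x(v := 0)) + a * \<beta>"
    and nonzero: "\<And>t. t \<in> T \<Longrightarrow> \<exists>x. (\<forall>v. v \<notin> X \<longrightarrow> x v = x0 v) \<and> P t x \<noteq> 0"
    and few: "\<And>v. \<lbrakk>v \<in> X; finite (UNIV :: 'a set)\<rbrakk> \<Longrightarrow>
      card {t \<in> T. \<exists>x a. (\<forall>v'. v' \<notin> X \<longrightarrow> x v' = x0 v') \<and> P t (x(v := a)) \<noteq> P t x} < card (UNIV :: 'a set)"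
  shows "\<exists>x. (\<forall>v. v \<notin> X \<longrightarrow> x v = x0 v) \<and> (\<forall>t\<in>T. P t x \<noteq> 0)"
  using \<open>finite X\<close> affine nonzero few
proof (induction X arbitrary: x0 rule: finite_induct)
  case empty
  have "x = x0" if "\<forall>v. v \<notin> {} \<longrightarrow> x v = x0 v" for x
    using that by auto
  with empty.prems(2) show ?case
    by (intro exI[of _ x0]) blast
next
  case (insert v X)
  let ?agree = "\<lambda>x. \<forall>v'. v' \<notin> insert v X \<longrightarrow> x v' = x0 v'"
  let ?rel = "{t \<in> T. \<exists>x a. ?agree x \<and> P t (x(v := a)) \<noteq> P t x}"
  define bad where "bad t a \<longleftrightarrow> (\<forall>x. ?agree x \<longrightarrow> x v = a \<longrightarrow> P t x = 0)" for t a
  have bad_unique: "a = a'" if t: "t \<in> T" and ba: "bad t a" "bad t a'" for t a a'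
  proof (rule ccontr)
    assume "a \<noteq> a'"
    obtain x where x: "?agree x" "P t x \<noteq> 0"
      using insert.prems(2)[OF t] by blast
    obtain \<beta> where \<beta>: "\<And>a. P t (x(v := a)) = P t (x(v := 0)) + a * \<beta>"
      using insert.prems(1)[OF t, of v x] by blast
    have *: "P t (x(v := a)) = 0" "P t (x(v := a')) = 0"
      using ba x(1) unfolding bad_def by (metis fun_upd_apply insertCI)+
    have "(a - a') * \<beta> = P t (x(v := a)) - P t (x(v := a'))"
      by (subst (1 2) \<beta>) (simp add: algebra_simps)
    then have "(a - a') * \<beta> = 0"
      using * by simp
    with \<open>a \<noteq> a'\<close> have "\<beta> = 0"
      by simp
    with * \<beta>[of a] \<beta>[of "x v"] have "P t (x(v := x v)) = 0"
      by (simp del: fun_upd_triv)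
    with x(2) show False
      by simp
  qed
  have bad_rel: "t \<in> ?rel" if t: "t \<in> T" and b: "bad t a" for t a
  proof -
    obtain x where x: "?agree x" "P t x \<noteq> 0"
      using insert.prems(2)[OF t] by blast
    have "P t (x(v := a)) = 0"
      using b x(1) unfolding bad_def by (metis fun_upd_apply insertCI)
    with x have "?agree x \<and> P t (x(v := a)) \<noteq> P t x"
      by simp
    with t show ?thesis
      by blast
  qed
  define B where "B = {a. \<exists>t\<in>T. bad t a}"
  have B_sub: "B \<subseteq> (\<lambda>t. SOME a. bad t a) ` ?rel"
  proof
    fix a assume "a \<in> B"
    then obtain t where t: "t \<in> T" "bad t a"
      unfolding B_def by blast
    then have "(SOME a. bad t a) = a"
      using bad_unique by (meson someI)
    with bad_rel[OF t] show "a \<in> (\<lambda>t. SOME a. bad t a) ` ?rel"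
      by (metis (no_types, lifting) image_eqI)
  qed
  have fin_rel: "finite ?rel"
    using \<open>finite T\<close> by simp
  have "B \<noteq> UNIV"
  proof
    assume B: "B = UNIV"
    then have fin: "finite (UNIV :: 'a set)"
      using finite_surj[OF fin_rel B_sub] by simp
    have "card (UNIV :: 'a set) \<le> card ?rel"
      using surj_card_le[OF fin_rel B_sub] B by simp
    then show False
      using insert.prems(3)[OF insertI1 fin] by (rule leD[THEN notE])
  qed
  then obtain a where a: "a \<notin> B"
    by blast
  have "\<exists>x. (\<forall>v'. v' \<notin> X \<longrightarrow> x v' = (x0(v := a)) v') \<and> (\<forall>t\<in>T. P t x \<noteq> 0)"
  proof (rule insert.IH)
    show "\<exists>\<beta>. \<forall>a. P t (x(v' := a)) = P t (x(v' := 0)) + a * \<beta>" if "t \<in> T" "v' \<in> X" for t v' x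
      by (rule insert.prems(1)[OF that(1) insertI2[OF that(2)]])
    show "\<exists>x. (\<forall>v'. v' \<notin> X \<longrightarrow> x v' = (x0(v := a)) v') \<and> P t x \<noteq> 0" if "t \<in> T" for t
    proof -
      have "\<not> bad t a"
        using a that by (auto simp: B_def)
      then obtain x where "?agree x" "x v = a" "P t x \<noteq> 0"
        unfolding bad_def by blast
      then show ?thesis
        by (intro exI[of _ x]) auto
    qed
    fix v' assume v': "v' \<in> X" and fin: "finite (UNIV :: 'a set)"
    have "{t \<in> T. \<exists>x b. (\<forall>v''. v'' \<notin> X \<longrightarrow> x v'' = (x0(v := a)) v'') \<and> P t (x(v' := b)) \<noteq> P t x}
      \<subseteq> {t \<in> T. \<exists>x b. ?agree x \<and> P t (x(v' := b)) \<noteq> P t x}"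
    proof (rule Collect_mono, intro impI, elim conjE exE, intro conjI)
      fix t x b
      assume "\<forall>v''. v'' \<notin> X \<longrightarrow> x v'' = (x0(v := a)) v''" "P t (x(v' := b)) \<noteq> P t x"
      moreover from this have "?agree x"
        by simp
      ultimately show "\<exists>x b. ?agree x \<and> P t (x(v' := b)) \<noteq> P t x"
        by blast
    qed
    then have "card {t \<in> T. \<exists>x b. (\<forall>v''. v'' \<notin> X \<longrightarrow> x v'' = (x0(v := a)) v'') \<and> P t (x(v' := b)) \<noteq> P t x}
      \<le> card {t \<in> T. \<exists>x b. ?agree x \<and> P t (x(v' := b)) \<noteq> P t x}"
      by (rule card_mono[OF finite_subset[OF Collect_restrict \<open>finite T\<close>]])
    also have "\<dots> < card (UNIV :: 'a set)"
      by (rule insert.prems(3)[OF insertI2[OF v'] fin])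
    finally show "card {t \<in> T. \<exists>x b. (\<forall>v''. v'' \<notin> X \<longrightarrow> x v'' = (x0(v := a)) v'') \<and> P t (x(v' := b)) \<noteq> P t x}
      < card (UNIV :: 'a set)" .
  qed
  then obtain x where "\<forall>v'. v' \<notin> X \<longrightarrow> x v' = (x0(v := a)) v'" "\<forall>t\<in>T. P t x \<noteq> 0"
    by blast
  then show ?case
    by (intro exI[of _ x]) auto
qed

section \<open>Counting the positions that meet a row\<close>

text \<open>
  The positions are injected into \<open>{a..<a+r} \<times> {..<n-r}\<close>. Those with \<open>i \<noteq> a\<close> map to \<open>(j, i)\<close>, where \<open>i \<le> j - r\<close>; so
  the pairs \<open>(a, s)\<close> with \<open>s > a - r\<close> remain free, and they receive the positions \<open>(a, j)\<close> of row \<open>a\<close> at \<open>s = j - r\<close>.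
\<close>

lemma card_positions_meeting:
  assumes "1 \<le> r"
  shows "card {(i, j). i + r \<le> j \<and> j < n \<and> (a = i \<or> j + 1 - r \<le> a \<and> a \<le> j)} \<le> r * (n - r)"
proof -
  let ?D = "{(i, j). i + r \<le> j \<and> j < n \<and> (a = i \<or> j + 1 - r \<le> a \<and> a \<le> j)}"
  let ?\<pi> = "\<lambda>(i, j). if a = i then (a, j - r) else (j, i)"
  have "card ?D \<le> card ({a..<a + r} \<times> {..<n - r})"
  proof (rule card_inj_on_le)
    show "inj_on ?\<pi> ?D"
      using assms by (fastforce simp: inj_on_def split: if_splits)
    show "?\<pi> ` ?D \<subseteq> {a..<a + r} \<times> {..<n - r}"
      using assms by (auto split: if_splits)
  qed simp
  then show ?thesis
    by simp
qed

text \<open>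
  With \<open>N = n - r\<close>, twice the difference of the two sides is \<open>(r - N)\<^sup>2 + (r - 1)\<^sup>2 + (N - 1)\<^sup>2 - 2\<close>, which is
  negative for positive \<open>r\<close> and \<open>N\<close> only if \<open>r = N = 1\<close>.
\<close>

lemma three_times_product_le:
  fixes r n :: nat
  assumes "1 \<le> r" "r < n" "3 \<le> n"
  shows "3 * (r * (n - r)) \<le> n * (n - 1)"
proof -
  obtain N where N: "n = r + N" "1 \<le> N"
    using assms by (metis less_imp_add_positive Suc_leI One_nat_def)
  have "3 * (int r * int N) \<le> (int r + int N) * (int r + int N - 1)"
  proof -
    have "2 \<le> (int r - int N)\<^sup>2 + (int r - 1)\<^sup>2 + (int N - 1)\<^sup>2"
    proof (cases "r = N")
      case True
      then have "1 \<le> (int r - 1)\<^sup>2" "1 \<le> (int N - 1)\<^sup>2"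
        using assms N by (auto intro!: one_le_power)
      moreover have "0 \<le> (int r - int N)\<^sup>2"
        by simp
      ultimately show ?thesis
        by linarith
    next
      case False
      then have "0 < (int r - int N)\<^sup>2" "0 < (int r - 1)\<^sup>2 \<or> 0 < (int N - 1)\<^sup>2"
        by auto
      moreover have "0 \<le> (int r - 1)\<^sup>2" "0 \<le> (int N - 1)\<^sup>2"
        by simp_all
      ultimately show ?thesis
        by linarith
    qed
    then show ?thesis
      by (simp add: power2_eq_square algebra_simps)
  qed
  moreover have "int (n - 1) = int r + int N - 1"
    using N assms by simp
  ultimately have "int (3 * (r * (n - r))) \<le> int (n * (n - 1))"
    using N by simp
  then show ?thesis
    by (simp only: of_nat_le_iff)
qed

text \<open>
  The bound \<open>3r(n-r) \<le> n(n-1)\<close> fails for \<open>n = 2\<close> and \<open>r = 1\<close>; there \<open>r(n-r) = 1\<close>, and the two elements \<open>0\<close> and \<open>1\<close>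
  of the field suffice.
\<close>

lemma field_large_enough:
  assumes fin: "finite (UNIV :: 'k::field set)" and "2 \<le> n" "1 \<le> r"
    and large: "real (card (UNIV :: 'k set)) > real n * (real n - 1) / 3"
  shows "r * (n - r) < card (UNIV :: 'k set)"
proof -
  have two: "2 \<le> card (UNIV :: 'k set)"
    using card_mono[OF fin subset_UNIV, of "{0, 1}"] by simp
  consider "n \<le> r" | "n = 2" "r = 1" | "r < n" "3 \<le> n"
    using assms by linarith
  then show ?thesis
  proof cases
    case 3
    have "real (3 * (r * (n - r))) \<le> real (n * (n - 1))"
      using three_times_product_le[OF \<open>1 \<le> r\<close> 3] by (simp only: of_nat_le_iff)
    also have "\<dots> < real (3 * card (UNIV :: 'k set))"
      using large \<open>2 \<le> n\<close> by (simp add: of_nat_diff)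
    finally show ?thesis
      by (simp only: of_nat_less_iff)
  qed (use two in auto)
qed

section \<open>Entries of products of matrices\<close>

text \<open>
  The \<open>(i, j)\<close> entry of the product of \<open>n \<times> n\<close> matrices along a word. The matrices are given by their
  entry functions, which makes substituting a matrix for one letter a plain function update.
\<close>

primrec path_sum :: "nat \<Rightarrow> ('l \<Rightarrow> nat \<Rightarrow> nat \<Rightarrow> 'a::field) \<Rightarrow> 'l list \<Rightarrow> nat \<Rightarrow> nat \<Rightarrow> 'a" where
  "path_sum n u [] i j = of_bool (i = j)"
| "path_sum n u (l # w) i j = (\<Sum>a<n. u l i a * path_sum n u w a j)"

definition mat_unit :: "nat \<Rightarrow> nat \<Rightarrow> nat \<Rightarrow> nat \<Rightarrow> 'a::field" where
  "mat_unit a b = (\<lambda>i j. of_bool (i = a \<and> j = b))"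

text \<open>
  The units \<open>e\<^bsub>f l, g l\<^esub>\<close> multiply along the word to \<open>e\<^bsub>i, j\<^esub>\<close>. The empty word is a route from each vertex to itself.
\<close>

primrec is_route :: "('l \<Rightarrow> nat) \<Rightarrow> ('l \<Rightarrow> nat) \<Rightarrow> nat \<Rightarrow> 'l list \<Rightarrow> nat \<Rightarrow> bool" where
  "is_route f g i [] j \<longleftrightarrow> i = j"
| "is_route f g i (l # w) j \<longleftrightarrow> f l = i \<and> is_route f g (g l) w j"

lemma path_sum_cong:
  assumes "\<And>l a b. \<lbrakk>l \<in> set w; a < n; b < n\<rbrakk> \<Longrightarrow> u l a b = u' l a b" and "i < n"
  shows "path_sum n u w i j = path_sum n u' w i j"
  using assms by (induction w arbitrary: i) auto

lemma path_sum_upd_absent [simp]: "l \<notin> set w \<Longrightarrow> path_sum n (u(l := A)) w i j = path_sum n u w i j"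
  by (induction w arbitrary: i) auto

lemma path_sum_linear:
  assumes "distinct w" "l \<in> set w"
  shows "path_sum n (u(l := (\<lambda>a b. A a b + s * B a b))) w i j =
    path_sum n (u(l := A)) w i j + s * path_sum n (u(l := B)) w i j"
  using assms
proof (induction w arbitrary: i)
  case (Cons k w)
  show ?case
  proof (cases "k = l")
    case True
    with Cons.prems have "l \<notin> set w"
      by simp
    then show ?thesis
      unfolding True path_sum.simps path_sum_upd_absent[OF \<open>l \<notin> set w\<close>] fun_upd_same
      by (simp add: sum.distrib sum_distrib_left algebra_simps)
  next
    case False
    with Cons show ?thesis
      by (simp add: sum.distrib sum_distrib_left algebra_simps)
  qed
qed simp

lemma path_sum_expand:
  assumes "distinct w" "l \<in> set w" "i < n"
  shows "path_sum n (u(l := A)) w i j =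
    (\<Sum>a<n. \<Sum>b<n. A a b * path_sum n (u(l := mat_unit a b)) w i j)"
  using assms
proof (induction w arbitrary: i)
  case (Cons k w)
  show ?case
  proof (cases "k = l")
    case True
    have *: "(\<Sum>x<n. mat_unit a b i x * path_sum n u w x j) = of_bool (i = a) * path_sum n u w b j"
      if "b < n" for a b
    proof -
      have "(\<Sum>x<n. mat_unit a b i x * path_sum n u w x j) =
          (\<Sum>x<n. if x = b then of_bool (i = a) * path_sum n u w b j else 0)"
        by (intro sum.cong) (auto simp: mat_unit_def)
      then show ?thesis
        using that by (simp add: sum.delta)
    qed
    have "(\<Sum>a<n. \<Sum>b<n. A a b * (of_bool (i = a) * path_sum n u w b j)) =
        (\<Sum>a<n. if a = i then \<Sum>b<n. A i b * path_sum n u w b j else 0)"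
      by (intro sum.cong) auto
    moreover have "l \<notin> set w"
      using True Cons.prems by simp
    ultimately show ?thesis
      unfolding True path_sum.simps path_sum_upd_absent[OF \<open>l \<notin> set w\<close>] fun_upd_same
      using * Cons.prems by (simp add: sum.delta)
  next
    case False
    have "path_sum n (u(l := A)) w x j = (\<Sum>a<n. \<Sum>b<n. A a b * path_sum n (u(l := mat_unit a b)) w x j)"
      if "x < n" for x
      using Cons.prems False by (intro Cons.IH that) auto
    then have "path_sum n (u(l := A)) (k # w) i j =
        (\<Sum>x<n. u k i x * (\<Sum>a<n. \<Sum>b<n. A a b * path_sum n (u(l := mat_unit a b)) w x j))"
      using False by simp
    also have "\<dots> = (\<Sum>x<n. \<Sum>a<n. \<Sum>b<n. A a b * (u k i x * path_sum n (u(l := mat_unit a b)) w x j))"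
      by (simp add: sum_distrib_left mult_ac)
    also have "\<dots> = (\<Sum>a<n. \<Sum>x<n. \<Sum>b<n. A a b * (u k i x * path_sum n (u(l := mat_unit a b)) w x j))"
      by (rule sum.swap)
    also have "\<dots> = (\<Sum>a<n. \<Sum>b<n. \<Sum>x<n. A a b * (u k i x * path_sum n (u(l := mat_unit a b)) w x j))"
      by (intro sum.cong refl sum.swap)
    also have "\<dots> = (\<Sum>a<n. \<Sum>b<n. A a b * path_sum n (u(l := mat_unit a b)) (k # w) i j)"
      using False by (simp add: sum_distrib_left)
    finally show ?thesis .
  qed
qed simp

lemma path_sum_mat_units:
  assumes "\<And>l. l \<in> set w \<Longrightarrow> g l < n"
  shows "path_sum n (\<lambda>l. mat_unit (f l) (g l)) w i j = (of_bool (is_route f g i w j) :: 'a::field)"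
  using assms
proof (induction w arbitrary: i)
  case (Cons l w)
  have "path_sum n (\<lambda>l. mat_unit (f l) (g l) :: nat \<Rightarrow> nat \<Rightarrow> 'a) (l # w) i j =
      (\<Sum>a<n. if a = g l then of_bool (f l = i) * of_bool (is_route f g (g l) w j) else 0)"
    using Cons by (auto simp: mat_unit_def intro!: sum.cong)
  with Cons.prems show ?case
    by (simp add: sum.delta)
qed simp

lemma path_sum_identity:
  assumes "i < n" "\<And>l a b. l \<in> set w \<Longrightarrow> u l a b = of_bool (a = b)"
  shows "path_sum n u w i j = of_bool (i = j)"
  using assms
proof (induction w arbitrary: i)
  case (Cons l w)
  have "path_sum n u (l # w) i j = (\<Sum>a<n. if a = i then of_bool (i = j) else 0)"
    using Cons by (auto intro!: sum.cong)
  with Cons.prems show ?case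
    by (simp add: sum.delta)
qed simp

lemma path_sum_single_letter:
  assumes "i < n" "j < n" "distinct w" "k \<in> set w"
    and "\<And>l a b. \<lbrakk>l \<in> set w; l \<noteq> k\<rbrakk> \<Longrightarrow> u l a b = of_bool (a = b)"
  shows "path_sum n u w i j = u k i j"
  using assms
proof (induction w arbitrary: i)
  case (Cons l w)
  show ?case
  proof (cases "l = k")
    case True
    have "path_sum n u w a j = of_bool (a = j)" if "a < n" for a
    proof (rule path_sum_identity[OF that])
      fix m b c assume "m \<in> set w"
      with True Cons.prems show "u m b c = of_bool (b = c)"
        by (intro Cons.prems(5)) auto
    qed
    then have "path_sum n u (l # w) i j = (\<Sum>a<n. if a = j then u k i j else 0)"
      unfolding path_sum.simps using True by (intro sum.cong) auto
    with Cons.prems show ?thesis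
      by (simp add: sum.delta)
  next
    case False
    have IH: "path_sum n u w i j = u k i j"
      using False Cons.prems by (intro Cons.IH) auto
    have "u l i a = of_bool (i = a)" for a
      using False Cons.prems(5) by simp
    with IH have "path_sum n u (l # w) i j = (\<Sum>a<n. if a = i then u k i j else 0)"
      unfolding path_sum.simps by (intro sum.cong) auto
    with Cons.prems show ?thesis
      by (simp add: sum.delta)
  qed
qed simp

section \<open>Routes\<close>

lemma is_route_append: "is_route f g i (w1 @ w2) j \<longleftrightarrow> (\<exists>k. is_route f g i w1 k \<and> is_route f g k w2 j)"
  by (induction w1 arbitrary: i) auto

lemma is_route_le: "\<lbrakk>is_route f g i w j; \<forall>l\<in>set w. f l \<le> g l\<rbrakk> \<Longrightarrow> i \<le> j"
  by (induction w arbitrary: i) force+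

lemma is_route_bounds:
  assumes "is_route f g i w j" "\<forall>l\<in>set w. f l \<le> g l" "l \<in> set w"
  shows "i \<le> f l" "g l \<le> j"
proof -
  obtain w1 w2 where w: "w = w1 @ l # w2"
    using assms(3) split_list by metis
  with assms have "is_route f g i w1 (f l)" "is_route f g (g l) w2 j"
    by (auto simp: is_route_append)
  with assms w show "i \<le> f l" "g l \<le> j"
    by (auto intro: is_route_le)
qed

text \<open>
  One of two distinct letters comes first in the word, and vertices never decrease along a route.
\<close>

lemma is_route_before_or_after:
  assumes "is_route f g i w j" "\<forall>l\<in>set w. f l \<le> g l" "l \<in> set w" "k \<in> set w" "l \<noteq> k"
  shows "g l \<le> f k \<or> g k \<le> f l"
proof -
  obtain w1 w2 where w: "w = w1 @ k # w2"
    using assms(4) split_list by metis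
  with assms have "is_route f g i w1 (f k)" "is_route f g (g k) w2 j"
    by (auto simp: is_route_append)
  with assms w show ?thesis
    using is_route_bounds[of f g i w1 "f k" l] is_route_bounds[of f g "g k" w2 j l] by auto
qed

lemma is_route_length:
  assumes "is_route f g i w j" "\<forall>l\<in>set w. f l \<le> g l" "distinct w"
  shows "j = i + (\<Sum>l\<in>set w. g l - f l)"
  using assms
proof (induction w arbitrary: i)
  case (Cons l w)
  then have "j = g l + (\<Sum>l\<in>set w. g l - f l)" "f l = i" "i \<le> g l"
    by auto
  with Cons.prems show ?case
    by simp
qed simp

lemma is_route_vertex:
  assumes "is_route f g i w j" "\<forall>l\<in>set w. f l \<le> g l" "v \<in> {i, j} \<union> f ` set w \<union> g ` set w"
  shows "v = i \<or> (\<exists>l\<in>set w. f l < g l \<and> g l = v)"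
  using assms
proof (induction w arbitrary: i)
  case (Cons l w)
  then have "v = i \<or> v = g l \<or> (\<exists>l\<in>set w. f l < g l \<and> g l = v)"
    by auto
  with Cons.prems show ?case
    by (cases "f l = g l") auto
qed auto

lemma is_route_relabel:
  assumes "inj_on \<phi> A" "i \<in> A" "j \<in> A" "f ` set w \<subseteq> A" "g ` set w \<subseteq> A"
  shows "is_route (\<phi> \<circ> f) (\<phi> \<circ> g) (\<phi> i) w (\<phi> j) \<longleftrightarrow> is_route f g i w j"
  using assms by (induction w arbitrary: i) (auto simp: inj_on_eq_iff)

text \<open>
  The sum \<open>f l + g l\<close> recovers the order of the letters up to loops at the same vertex.
\<close>

lemma is_route_sorted:
  assumes "is_route f g i w j" "\<forall>l\<in>set w. f l \<le> g l"
  shows "sorted (map (\<lambda>l. f l + g l) w)"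
  using assms
proof (induction w arbitrary: i)
  case (Cons l w)
  then have "\<forall>k\<in>set w. g l \<le> f k"
    using is_route_bounds(1)[of f g "g l" w j] by auto
  with Cons show ?case
    by (auto intro!: add_mono intro: order_trans)
qed simp


section \<open>Multilinear forms and their minimal number of jumps\<close>

definition arrangements :: "'l set \<Rightarrow> 'l list set" where
  "arrangements V = {w. distinct w \<and> set w = V}"

lemma finite_arrangements: "finite V \<Longrightarrow> finite (arrangements V)"
  unfolding arrangements_def by (rule finite_subset[OF _ finite_subset_distinct]) auto

text \<open>
  A nonzero multilinear polynomial in the variables \<open>V\<close>, given by the coefficients of the words in which
  each variable occurs exactly once.
\<close>

locale multilinear_form =
  fixes V :: "'l set" and c :: "'l list \<Rightarrow> 'a::field"
  assumes finite_V: "finite V"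
    and nonzero: "\<exists>w\<in>arrangements V. c w \<noteq> 0"
begin

definition form_entry :: "nat \<Rightarrow> ('l \<Rightarrow> nat \<Rightarrow> nat \<Rightarrow> 'a) \<Rightarrow> nat \<Rightarrow> nat \<Rightarrow> 'a" where
  "form_entry n u i j = (\<Sum>w\<in>arrangements V. c w * path_sum n u w i j)"

text \<open>
  The value at matrix units. It is defined through routes rather than as a special case of \<open>form_entry\<close>
  so that it does not refer to a matrix size and the vertices can be arbitrary numbers.
\<close>

definition route_coeff :: "('l \<Rightarrow> nat) \<Rightarrow> ('l \<Rightarrow> nat) \<Rightarrow> nat \<Rightarrow> nat \<Rightarrow> 'a" where
  "route_coeff f g i j = (\<Sum>w\<in>arrangements V. c w * of_bool (is_route f g i w j))"

lemma form_entry_cong: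
  assumes "\<And>l a b. \<lbrakk>l \<in> V; a < n; b < n\<rbrakk> \<Longrightarrow> u l a b = u' l a b" and "i < n"
  shows "form_entry n u i j = form_entry n u' i j"
  unfolding form_entry_def
proof (intro sum.cong refl arg_cong2[where f = "(*)"] path_sum_cong)
qed (use assms in \<open>auto simp: arrangements_def\<close>)

lemma form_entry_linear:
  assumes "l \<in> V"
  shows "form_entry n (u(l := (\<lambda>a b. A a b + s * B a b))) i j = form_entry n (u(l := A)) i j + s * form_entry n (u(l := B)) i j"
proof -
  have "path_sum n (u(l := (\<lambda>a b. A a b + s * B a b))) w i j =
      path_sum n (u(l := A)) w i j + s * path_sum n (u(l := B)) w i j" if "w \<in> arrangements V" for w
    using assms that by (intro path_sum_linear) (auto simp: arrangements_def)
  then have "form_entry n (u(l := (\<lambda>a b. A a b + s * B a b))) i j = (\<Sum>w\<in>arrangements V.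
      c w * (path_sum n (u(l := A)) w i j + s * path_sum n (u(l := B)) w i j))"
    unfolding form_entry_def by (intro sum.cong) auto
  then show ?thesis
    unfolding form_entry_def by (simp add: sum.distrib sum_distrib_left algebra_simps)
qed

lemma form_entry_expand:
  assumes "l \<in> V" "i < n"
  shows "form_entry n (u(l := A)) i j = (\<Sum>a<n. \<Sum>b<n. A a b * form_entry n (u(l := mat_unit a b)) i j)"
proof -
  have "path_sum n (u(l := A)) w i j = (\<Sum>a<n. \<Sum>b<n. A a b * path_sum n (u(l := mat_unit a b)) w i j)"
    if "w \<in> arrangements V" for w
    using assms that by (intro path_sum_expand) (auto simp: arrangements_def)
  then have "form_entry n (u(l := A)) i j = (\<Sum>w\<in>arrangements V.
      c w * (\<Sum>a<n. \<Sum>b<n. A a b * path_sum n (u(l := mat_unit a b)) w i j))"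
    unfolding form_entry_def by (intro sum.cong) auto
  also have "\<dots> = (\<Sum>w\<in>arrangements V. \<Sum>a<n. \<Sum>b<n.
      A a b * (c w * path_sum n (u(l := mat_unit a b)) w i j))"
    by (simp add: sum_distrib_left mult_ac)
  also have "\<dots> = (\<Sum>a<n. \<Sum>w\<in>arrangements V. \<Sum>b<n.
      A a b * (c w * path_sum n (u(l := mat_unit a b)) w i j))"
    by (rule sum.swap)
  also have "\<dots> = (\<Sum>a<n. \<Sum>b<n. \<Sum>w\<in>arrangements V.
      A a b * (c w * path_sum n (u(l := mat_unit a b)) w i j))"
    by (intro sum.cong refl sum.swap)
  also have "\<dots> = (\<Sum>a<n. \<Sum>b<n. A a b * form_entry n (u(l := mat_unit a b)) i j)"
    by (simp add: form_entry_def sum_distrib_left)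
  finally show ?thesis .
qed

lemma form_entry_mat_units:
  assumes "\<And>l. l \<in> V \<Longrightarrow> g l < n"
  shows "form_entry n (\<lambda>l. mat_unit (f l) (g l)) i j = route_coeff f g i j"
  unfolding form_entry_def route_coeff_def
  by (intro sum.cong refl arg_cong2[where f = "(*)"] path_sum_mat_units)
    (use assms in \<open>auto simp: arrangements_def\<close>)

text \<open>
  A nonzero value is witnessed by matrix units at nonzero entries of the substituted matrices: by linearity
  in each variable, the matrices can be replaced one after another by one of the units they contain.
\<close>

lemma form_entry_support:
  assumes "i < n" "form_entry n u i j \<noteq> 0"
  obtains f g where "\<And>l. l \<in> V \<Longrightarrow> f l < n \<and> g l < n \<and> u l (f l) (g l) \<noteq> 0"
    and "route_coeff f g i j \<noteq> 0"
proof -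
  have "\<exists>f g. (\<forall>l\<in>S. f l < n \<and> g l < n \<and> u l (f l) (g l) \<noteq> 0) \<and>
      form_entry n (\<lambda>l. if l \<in> S then mat_unit (f l) (g l) else u l) i j \<noteq> 0" if "S \<subseteq> V" for S
    using finite_subset[OF that finite_V] that
  proof (induction S rule: finite_induct)
    case empty
    with assms show ?case
      by simp
  next
    case (insert k S)
    then obtain f g where fg: "\<forall>l\<in>S. f l < n \<and> g l < n \<and> u l (f l) (g l) \<noteq> 0"
      and ne: "form_entry n (\<lambda>l. if l \<in> S then mat_unit (f l) (g l) else u l) i j \<noteq> 0"
      by auto
    define u' where "u' = (\<lambda>l. if l \<in> S then mat_unit (f l) (g l) else u l)"
    have "u'(k := u k) = u'"
      using insert.hyps by (auto simp: u'_def)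
    then have "(\<Sum>a<n. \<Sum>b<n. u k a b * form_entry n (u'(k := mat_unit a b)) i j) \<noteq> 0"
      using ne form_entry_expand[of k i n u' "u k" j] insert.prems assms(1) by (simp add: u'_def)
    then obtain a where a: "a < n" "(\<Sum>b<n. u k a b * form_entry n (u'(k := mat_unit a b)) i j) \<noteq> 0"
      by (meson lessThan_iff sum.not_neutral_contains_not_neutral)
    then obtain b where b: "b < n" "u k a b * form_entry n (u'(k := mat_unit a b)) i j \<noteq> 0"
      by (meson lessThan_iff sum.not_neutral_contains_not_neutral)
    have "u'(k := mat_unit a b) =
        (\<lambda>l. if l \<in> insert k S then mat_unit ((f(k := a)) l) ((g(k := b)) l) else u l)"
      using insert.hyps by (auto simp: u'_def)
    with a b fg insert.hyps show ?case
      by (intro exI[of _ "f(k := a)"] exI[of _ "g(k := b)"]) auto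
  qed
  then obtain f g where fg: "\<forall>l\<in>V. f l < n \<and> g l < n \<and> u l (f l) (g l) \<noteq> 0"
    and ne: "form_entry n (\<lambda>l. if l \<in> V then mat_unit (f l) (g l) else u l) i j \<noteq> 0"
    by blast
  have "form_entry n (\<lambda>l. if l \<in> V then mat_unit (f l) (g l) else u l) i j = form_entry n (\<lambda>l. mat_unit (f l) (g l)) i j"
    using assms(1) by (intro form_entry_cong) auto
  also have "\<dots> = route_coeff f g i j"
    using fg by (intro form_entry_mat_units) auto
  finally show thesis
    using fg ne by (intro that[of f g]) auto
qed

lemma route_coeff_nonzero_imp_route:
  assumes "route_coeff f g i j \<noteq> 0"
  obtains w where "distinct w" "set w = V" "is_route f g i w j"
proof -
  obtain w where "w \<in> arrangements V" "c w * of_bool (is_route f g i w j) \<noteq> 0"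
    using assms unfolding route_coeff_def by (meson sum.not_neutral_contains_not_neutral)
  then show thesis
    by (intro that[of w]) (auto simp: arrangements_def)
qed

lemma route_coeff_relabel:
  assumes "inj_on \<phi> A" "i \<in> A" "j \<in> A" "f ` V \<subseteq> A" "g ` V \<subseteq> A"
  shows "route_coeff (\<phi> \<circ> f) (\<phi> \<circ> g) (\<phi> i) (\<phi> j) = route_coeff f g i j"
  unfolding route_coeff_def
  by (intro sum.cong refl arg_cong2[where f = "(*)"] arg_cong[where f = of_bool] is_route_relabel)
    (use assms in \<open>auto simp: arrangements_def\<close>)

text \<open>
  The largest \<open>r\<close> such that the form is a polynomial identity of the \<open>r \<times> r\<close> upper triangular matrices. Units with \<open>q\<close>
  jumps visit \<open>q + 1\<close> vertices when they compose to a route.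
\<close>

definition jump_rank :: nat where
  "jump_rank = (LEAST q. \<exists>f g i j. (\<forall>l\<in>V. f l \<le> g l) \<and> route_coeff f g i j \<noteq> 0 \<and>
     card {l \<in> V. f l < g l} = q)"

lemma jump_rank_le:
  assumes "\<And>l. l \<in> V \<Longrightarrow> f l \<le> g l" "route_coeff f g i j \<noteq> 0"
  shows "jump_rank \<le> card {l \<in> V. f l < g l}"
  unfolding jump_rank_def using assms by (intro Least_le) blast

lemma jumps_le_distance:
  assumes "\<And>l. l \<in> V \<Longrightarrow> f l \<le> g l" "route_coeff f g i j \<noteq> 0"
  shows "i + card {l \<in> V. f l < g l} \<le> j"
proof -
  obtain w where w: "distinct w" "set w = V" "is_route f g i w j"
    using route_coeff_nonzero_imp_route assms(2) by blast
  have "card {l \<in> V. f l < g l} = (\<Sum>l\<in>V. of_bool (f l < g l))"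
    using finite_V by (simp add: Int_def)
  also have "\<dots> \<le> (\<Sum>l\<in>V. g l - f l)"
    by (intro sum_mono) auto
  finally show ?thesis
    using is_route_length[of f g i w j] w assms(1) by simp
qed

text \<open>
  The letters at even positions (counted from \<open>0\<close>) become loops, those at odd positions become jumps to the next vertex. Then
  \<open>f l + g l\<close> is the position of \<open>l\<close>, and since it increases along routes, it determines the word.
\<close>

lemma alternating_route:
  assumes w: "w \<in> arrangements V"
  obtains f g where "\<And>l. l \<in> V \<Longrightarrow> f l \<le> g l" "route_coeff f g 0 (length w div 2) = c w"
proof -
  have dw: "distinct w" and sw: "set w = V"
    using w by (auto simp: arrangements_def)
  define pos where "pos = the_inv_into {..<length w} ((!) w)"
  have pos: "pos (w ! k) = k" if "k < length w" for k
    unfolding pos_def using dw that by (intro the_inv_into_f_f) (auto simp: inj_on_nth)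
  define f g where "f l = pos l div 2" and "g l = Suc (pos l) div 2" for l
  have fg: "f l + g l = pos l" for l
    unfolding f_def g_def by presburger
  have le: "f l \<le> g l" for l
    unfolding f_def g_def by presburger
  have "is_route f g (k div 2) (drop k w) (length w div 2)" if "k \<le> length w" for k
    using that
  proof (induction k rule: inc_induct)
    case (step k)
    then show ?case
      by (simp add: Cons_nth_drop_Suc[symmetric] f_def g_def pos)
  qed simp
  from this[of 0] have route: "is_route f g 0 w (length w div 2)"
    by simp
  have map_pos: "map pos w = [0..<length w]"
    using pos by (intro nth_equalityI) auto
  have inj: "inj_on pos V"
    using map_pos by (metis distinct_map distinct_upt sw)
  have unique: "w' = w" if "w' \<in> arrangements V" "is_route f g 0 w' (length w div 2)" for w'
  proof -
    have "sorted (map pos w')"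
      using is_route_sorted[OF that(2)] le by (simp add: fg)
    moreover have "distinct (map pos w')" "set (map pos w') = set (map pos w)"
      using that inj sw by (auto simp: arrangements_def distinct_map)
    ultimately have "map pos w' = map pos w"
      by (intro sorted_distinct_set_unique) (auto simp: map_pos)
    then show ?thesis
      using inj that(1) sw by (auto simp: arrangements_def inj_on_map_eq_map)
  qed
  have "route_coeff f g 0 (length w div 2) = (\<Sum>w'\<in>arrangements V. if w' = w then c w else 0)"
    unfolding route_coeff_def using unique route by (intro sum.cong) auto
  then have "route_coeff f g 0 (length w div 2) = c w"
    using w finite_V by (simp add: finite_arrangements)
  with le show thesis
    by (intro that)
qed

lemma jump_rank_le_half: "2 * jump_rank \<le> card V"
proof -
  obtain w where w: "w \<in> arrangements V" "c w \<noteq> 0"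
    using nonzero by blast
  obtain f g where fg: "\<And>l. l \<in> V \<Longrightarrow> f l \<le> g l" "route_coeff f g 0 (length w div 2) = c w"
    using alternating_route[OF w(1)] by blast
  with w(2) have ne: "route_coeff f g 0 (length w div 2) \<noteq> 0"
    by simp
  have "jump_rank \<le> length w div 2"
    using jump_rank_le[OF fg(1) ne] jumps_le_distance[OF fg(1) ne] by simp
  moreover have "length w = card V"
    using w by (auto simp: arrangements_def distinct_card)
  ultimately show ?thesis
    by simp
qed

lemma jump_rank_attained:
  obtains f g i j where "\<And>l. l \<in> V \<Longrightarrow> f l \<le> g l" "route_coeff f g i j \<noteq> 0"
    "card {l \<in> V. f l < g l} = jump_rank"
proof -
  obtain w where w: "w \<in> arrangements V" "c w \<noteq> 0"
    using nonzero by blast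
  obtain f g where "\<And>l. l \<in> V \<Longrightarrow> f l \<le> g l" "route_coeff f g 0 (length w div 2) = c w"
    using alternating_route[OF w(1)] by blast
  with w(2) have "\<exists>q f g i j. (\<forall>l\<in>V. f l \<le> g l) \<and> route_coeff f g i j \<noteq> 0 \<and> card {l \<in> V. f l < g l} = q"
    by metis
  from LeastI_ex[OF this] that show thesis
    unfolding jump_rank_def[symmetric] by blast
qed

lemma form_entry_nonzero_imp_distance:
  assumes "\<And>l a b. \<lbrakk>l \<in> V; b < a; a < n\<rbrakk> \<Longrightarrow> u l a b = 0" "i < n" "form_entry n u i j \<noteq> 0"
  shows "i + jump_rank \<le> j"
proof -
  obtain f g where fg: "\<And>l. l \<in> V \<Longrightarrow> f l < n \<and> g l < n \<and> u l (f l) (g l) \<noteq> 0"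
    and ne: "route_coeff f g i j \<noteq> 0"
    using form_entry_support[OF assms(2,3)] by blast
  have le: "f l \<le> g l" if "l \<in> V" for l
    using fg[OF that] assms(1)[OF that] by (meson not_le)
  have "jump_rank \<le> card {l \<in> V. f l < g l}"
    by (rule jump_rank_le[OF le ne])
  also have "i + card {l \<in> V. f l < g l} \<le> j"
    by (rule jumps_le_distance[OF le ne])
  finally show ?thesis
    by simp
qed

section \<open>Nonvanishing routes in canonical form\<close>

text \<open>
  Each vertex \<open>v\<close> of a route with \<open>jump_rank\<close> jumps is relabelled by the number \<open>\<psi> v\<close> of jumps made before leaving
  \<open>v\<close>. Every vertex but the first is the target of a jump, so \<open>\<psi>\<close> is injective on the vertices, and relabelling does
  not change \<open>route_coeff\<close>.
\<close>

lemma canonical_route: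
  obtains f g where "\<And>l. l \<in> V \<Longrightarrow> f l \<le> g l \<and> g l \<le> Suc (f l) \<and> g l \<le> jump_rank"
    and "route_coeff f g 0 jump_rank \<noteq> 0"
    and "bij_betw f {l \<in> V. f l < g l} {..<jump_rank}"
proof -
  obtain f g i j where le: "\<And>l. l \<in> V \<Longrightarrow> f l \<le> g l" and ne: "route_coeff f g i j \<noteq> 0"
    and card_J: "card {l \<in> V. f l < g l} = jump_rank"
    using jump_rank_attained by blast
  obtain w where w: "distinct w" "set w = V" "is_route f g i w j"
    using route_coeff_nonzero_imp_route[OF ne] by blast
  have le': "\<forall>l\<in>set w. f l \<le> g l"
    using le w(2) by simp
  define J where "J = {l \<in> V. f l < g l}"
  have fin: "finite J"
    using finite_V by (simp add: J_def)
  define \<psi> where "\<psi> v = card {l \<in> J. g l \<le> v}" for v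
  define A where "A = {i, j} \<union> f ` V \<union> g ` V"
  have bounds: "i \<le> f l" "g l \<le> j" if "l \<in> V" for l
    using is_route_bounds[OF w(3) le'] that w(2) by auto
  have order: "g l \<le> f k \<or> g k \<le> f l" if "l \<in> V" "k \<in> V" "l \<noteq> k" for l k
    using is_route_before_or_after[OF w(3) le'] that w(2) by auto
  have vertex: "v = i \<or> (\<exists>l\<in>J. g l = v)" if "v \<in> A" for v
    using is_route_vertex[OF w(3) le', of v] that w(2) by (auto simp: A_def J_def)
  have ge_i: "i \<le> v" if "v \<in> A" for v
    using vertex[OF that] bounds le by (fastforce simp: J_def)
  have \<psi>_mono: "\<psi> u \<le> \<psi> v" if "u \<le> v" for u v
    unfolding \<psi>_def using fin that by (intro card_mono) auto
  have \<psi>_less: "\<psi> u < \<psi> v" if uv: "u \<in> A" "v \<in> A" "u < v" for u v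
  proof -
    obtain l where "l \<in> J" "g l = v"
      using vertex[OF uv(2)] ge_i[OF uv(1)] uv(3) by auto
    then have "l \<in> {l \<in> J. g l \<le> v}" "l \<notin> {l \<in> J. g l \<le> u}"
      using uv(3) by auto
    then have "{l \<in> J. g l \<le> u} \<subset> {l \<in> J. g l \<le> v}"
      using uv(3) by fastforce
    then show ?thesis
      unfolding \<psi>_def using fin by (intro psubset_card_mono) auto
  qed
  have inj: "inj_on \<psi> A"
    by (rule linorder_inj_onI) (auto dest: \<psi>_less)
  have "{l \<in> J. g l \<le> i} = {}"
    using bounds(1) by (fastforce simp: J_def)
  then have \<psi>_i: "\<psi> i = 0"
    by (simp only: \<psi>_def card.empty)
  have "{l \<in> J. g l \<le> j} = J"
    using bounds by (auto simp: J_def)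
  then have \<psi>_j: "\<psi> j = jump_rank"
    using card_J by (simp add: \<psi>_def J_def)
  have \<psi>_jump: "\<psi> (g l) = Suc (\<psi> (f l))" if l: "l \<in> J" for l
  proof -
    have "{k \<in> J. g k \<le> g l} = insert l {k \<in> J. g k \<le> f l}"
      using l order[of _ l] by (fastforce simp: J_def)
    moreover have "l \<notin> {k \<in> J. g k \<le> f l}"
      using l by (auto simp: J_def)
    ultimately show ?thesis
      unfolding \<psi>_def using fin by simp
  qed
  have jumps: "{l \<in> V. (\<psi> \<circ> f) l < (\<psi> \<circ> g) l} = J"
  proof (intro equalityI subsetI)
    fix l assume l: "l \<in> {l \<in> V. (\<psi> \<circ> f) l < (\<psi> \<circ> g) l}"
    then have "f l \<noteq> g l"
      by auto
    with l le[of l] show "l \<in> J"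
      by (simp add: J_def)
  next
    fix l assume "l \<in> J"
    with \<psi>_jump[of l] show "l \<in> {l \<in> V. (\<psi> \<circ> f) l < (\<psi> \<circ> g) l}"
      by (simp add: J_def)
  qed
  have inj_J: "inj_on (\<psi> \<circ> f) J"
  proof (rule inj_onI)
    fix k l assume kl: "k \<in> J" "l \<in> J" "(\<psi> \<circ> f) k = (\<psi> \<circ> f) l"
    have "f k \<in> A" "f l \<in> A"
      using kl by (auto simp: A_def J_def)
    then have "f k = f l"
      using kl(3) inj_onD[OF inj] by simp
    with kl order[of k l] show "k = l"
      by (auto simp: J_def)
  qed
  have "(\<psi> \<circ> f) ` J \<subseteq> {..<jump_rank}"
  proof
    fix s assume "s \<in> (\<psi> \<circ> f) ` J"
    then obtain l where l: "l \<in> J" "s = \<psi> (f l)"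
      by auto
    then have "Suc s \<le> \<psi> j"
      using \<psi>_jump[OF l(1)] \<psi>_mono[of "g l" j] bounds by (auto simp: J_def)
    then show "s \<in> {..<jump_rank}"
      by (simp add: \<psi>_j)
  qed
  then have "(\<psi> \<circ> f) ` J = {..<jump_rank}"
    using card_J card_image[OF inj_J] by (intro card_subset_eq) (auto simp: J_def)
  with inj_J have bij: "bij_betw (\<psi> \<circ> f) {l \<in> V. (\<psi> \<circ> f) l < (\<psi> \<circ> g) l} {..<jump_rank}"
    unfolding jumps by (simp add: bij_betw_def)
  have "route_coeff (\<psi> \<circ> f) (\<psi> \<circ> g) (\<psi> i) (\<psi> j) = route_coeff f g i j"
    using inj by (rule route_coeff_relabel) (auto simp: A_def)
  then have "route_coeff (\<psi> \<circ> f) (\<psi> \<circ> g) 0 jump_rank \<noteq> 0"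
    using ne by (simp add: \<psi>_i \<psi>_j)
  moreover have "(\<psi> \<circ> f) l \<le> (\<psi> \<circ> g) l \<and> (\<psi> \<circ> g) l \<le> Suc ((\<psi> \<circ> f) l) \<and> (\<psi> \<circ> g) l \<le> jump_rank"
    if l: "l \<in> V" for l
  proof (cases "l \<in> J")
    case True
    then show ?thesis
      using \<psi>_jump[OF True] \<psi>_mono[OF bounds(2)[OF l]] by (simp add: \<psi>_j)
  next
    case False
    then have "f l = g l"
      using le[OF l] l by (auto simp: J_def)
    then show ?thesis
      using \<psi>_mono[OF bounds(2)[OF l]] by (simp add: \<psi>_j)
  qed
  ultimately show thesis
    using bij by (intro that[of "\<psi> \<circ> f" "\<psi> \<circ> g"])
qed

text \<open>
  Only the variables in \<open>J\<close> can jump, and there are \<open>jump_rank\<close> of them, so minimality forces all of them to jump.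
  Those other than \<open>k\<close> jump by exactly one, which determines the distance from \<open>i\<close> to \<open>j\<close>.
  Every other variable is used before or after the jump of \<open>k\<close>, hence nowhere strictly inside it.
\<close>

lemma route_shape:
  assumes ne: "route_coeff f g i j \<noteq> 0"
    and J: "J \<subseteq> V" "card J = jump_rank" "k \<in> J"
    and diag: "\<And>l. l \<in> V - J \<Longrightarrow> f l = g l"
    and bidiag: "\<And>l. l \<in> J - {k} \<Longrightarrow> f l \<le> g l \<and> g l \<le> Suc (f l)"
    and k_le: "f k \<le> g k"
  shows "j + f k + 1 = i + g k + jump_rank" and "i \<le> f k" and "g k \<le> j"
    and "\<And>l. l \<in> V - {k} \<Longrightarrow> i \<le> f l \<and> g l \<le> f k \<or> g k \<le> f l \<and> g l \<le> j"
proof -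
  have le: "f l \<le> g l" if "l \<in> V" for l
    using that diag bidiag k_le by (cases "l \<in> J"; cases "l = k") (auto simp: le_eq_less_or_eq)
  obtain w where w: "distinct w" "set w = V" "is_route f g i w j"
    using route_coeff_nonzero_imp_route[OF ne] by blast
  have le': "\<forall>l\<in>set w. f l \<le> g l"
    using le w(2) by simp
  have kV: "k \<in> V"
    using J by auto
  have bounds: "i \<le> f l" "g l \<le> j" if "l \<in> V" for l
    using is_route_bounds[OF w(3) le'] that w(2) by auto
  show "i \<le> f k" "g k \<le> j"
    using bounds[OF kV] .
  show "i \<le> f l \<and> g l \<le> f k \<or> g k \<le> f l \<and> g l \<le> j" if "l \<in> V - {k}" for l
    using is_route_before_or_after[OF w(3) le', of l k] bounds[of l] that kV w(2) by auto
  have finJ: "finite J"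
    using J finite_V finite_subset by blast
  have sub: "{l \<in> V. f l < g l} \<subseteq> J"
  proof
    fix l assume "l \<in> {l \<in> V. f l < g l}"
    then show "l \<in> J"
      using diag[of l] by (cases "l \<in> J") auto
  qed
  have "{l \<in> V. f l < g l} = J"
    using card_seteq[OF finJ sub] jump_rank_le[OF le ne] J(2) by simp
  then have jump: "f l < g l" if "l \<in> J" for l
    using that by blast
  have "(\<Sum>l\<in>V. g l - f l) = (\<Sum>l\<in>J. g l - f l)"
    using J(1) diag finite_V by (intro sum.mono_neutral_right) auto
  also have "\<dots> = (g k - f k) + (\<Sum>l\<in>J - {k}. g l - f l)"
    by (rule sum.remove[OF finJ J(3)])
  also have "(\<Sum>l\<in>J - {k}. g l - f l) = (\<Sum>l\<in>J - {k}. 1)"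
  proof (rule sum.cong[OF refl])
    fix l assume l: "l \<in> J - {k}"
    with jump[of l] bidiag[OF l] show "g l - f l = 1"
      by auto
  qed
  also have "\<dots> = jump_rank - 1"
    using J finJ by simp
  finally have "j = i + ((g k - f k) + (jump_rank - 1))"
    using is_route_length[OF w(3) le' w(1)] w(2) by simp
  moreover have "jump_rank \<ge> 1"
    using J finJ by (metis One_nat_def Suc_leI card_gt_0_iff empty_iff)
  ultimately show "j + f k + 1 = i + g k + jump_rank"
    using jump[OF J(3)] by simp
qed

section \<open>Substituting bidiagonal matrices for all variables but one\<close>

text \<open>
  The matrix of \<open>k\<close> is left unconstrained because it is the unknown of a linear system.
\<close>

definition bidiagonal_away :: "'l set \<Rightarrow> 'l \<Rightarrow> ('l \<Rightarrow> nat \<Rightarrow> nat \<Rightarrow> 'a) \<Rightarrow> bool" where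
  "bidiagonal_away J k u \<longleftrightarrow> (\<forall>l\<in>V - {k}. \<forall>a b. u l a b \<noteq> 0 \<longrightarrow> b = a \<or> l \<in> J \<and> b = Suc a)"

lemma bidiagonal_away_support:
  assumes shape: "bidiagonal_away J k u" and J: "J \<subseteq> V" "card J = jump_rank" "k \<in> J"
    and ab: "a \<le> b" and i: "i < n" and ne: "form_entry n (u(k := mat_unit a b)) i j \<noteq> 0"
  shows "j + a + 1 = i + b + jump_rank" "i \<le> a" "b \<le> j"
    and "\<exists>f g. \<forall>l\<in>V - {k}. u l (f l) (g l) \<noteq> 0 \<and>
      (i \<le> f l \<and> f l \<le> a \<or> b \<le> f l \<and> f l \<le> j)"
proof -
  obtain f g where fg: "\<And>l. l \<in> V \<Longrightarrow> f l < n \<and> g l < n \<and> (u(k := mat_unit a b)) l (f l) (g l) \<noteq> 0"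
    and rc: "route_coeff f g i j \<noteq> 0"
    using form_entry_support[OF i ne] by blast
  have k: "f k = a" "g k = b"
    using fg[of k] J by (auto simp: mat_unit_def)
  have u: "u l (f l) (g l) \<noteq> 0" if "l \<in> V - {k}" for l
    using fg[of l] that by simp
  have entry: "g l = f l \<or> l \<in> J \<and> g l = Suc (f l)" if "l \<in> V - {k}" for l
    using shape u[OF that] that unfolding bidiagonal_away_def by blast
  have diag: "f l = g l" if "l \<in> V - J" for l
    using entry[of l] that J(3) by (cases "l = k") auto
  have bidiag: "f l \<le> g l \<and> g l \<le> Suc (f l)" if "l \<in> J - {k}" for l
  proof -
    have "l \<in> V - {k}"
      using that J(1) by blast
    from entry[OF this] show ?thesis
      by auto
  qed
  have k_le: "f k \<le> g k"
    using k ab by simp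
  note rs = route_shape[OF rc J diag bidiag k_le, unfolded k]
  show "j + a + 1 = i + b + jump_rank" "i \<le> a" "b \<le> j"
    by (rule rs(1-3); assumption)+
  have "i \<le> f l \<and> f l \<le> a \<or> b \<le> f l \<and> f l \<le> j" if l: "l \<in> V - {k}" for l
  proof -
    have "i \<le> f l \<and> g l \<le> a \<or> b \<le> f l \<and> g l \<le> j"
      by (rule rs(4)[OF _ _ l])
    with entry[OF l] show ?thesis
      by auto
  qed
  with u show "\<exists>f g. \<forall>l\<in>V - {k}. u l (f l) (g l) \<noteq> 0 \<and>
      (i \<le> f l \<and> f l \<le> a \<or> b \<le> f l \<and> f l \<le> j)"
    by blast
qed


text \<open>
  The variables of the pivots, seen as multi-affine functions, are the entries \<open>(l, a, b)\<close> allowed by \<open>bidiagonal_away\<close>.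
  For the pivot at \<open>(i, j)\<close> a nonzero comes from the canonical route, moved by sending \<open>0\<close> to \<open>i\<close> and \<open>1, \<dots>, r\<close> to the
  last \<open>r\<close> vertices up to \<open>j\<close>: its first jump becomes \<open>i \<rightarrow> j - r + 1\<close> and its other jumps still have length one.
  A pivot depending on an entry in row \<open>a\<close> must have a route through \<open>a\<close>, which bounds the number of such pivots.
\<close>

lemma nonzero_pivots:
  assumes rank: "1 \<le> jump_rank"
    and large: "finite (UNIV :: 'a set) \<Longrightarrow> jump_rank * (n - jump_rank) < card (UNIV :: 'a set)"
  obtains J k u where "J \<subseteq> V" "card J = jump_rank" "k \<in> J" "bidiagonal_away J k u"
    and "\<And>i j. \<lbrakk>i + jump_rank \<le> j; j < n\<rbrakk> \<Longrightarrow> form_entry n (u(k := mat_unit i (j + 1 - jump_rank))) i j \<noteq> 0"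
proof -
  let ?r = jump_rank
  obtain f g where fg: "\<And>l. l \<in> V \<Longrightarrow> f l \<le> g l \<and> g l \<le> Suc (f l) \<and> g l \<le> ?r"
    and ne: "route_coeff f g 0 ?r \<noteq> 0"
    and bij: "bij_betw f {l \<in> V. f l < g l} {..<?r}"
    using canonical_route by blast
  define J where "J = {l \<in> V. f l < g l}"
  have J: "J \<subseteq> V" "card J = ?r"
    using bij_betw_same_card[OF bij] by (auto simp: J_def)
  have "0 \<in> f ` J"
    using bij rank by (simp add: J_def bij_betw_def)
  then obtain k where k: "k \<in> J" "f k = 0"
    by auto
  then have gk: "g k = 1"
    using fg[of k] by (auto simp: J_def)
  have f_pos: "0 < f l" if "l \<in> J" "l \<noteq> k" for l
    using that k bij by (auto simp: J_def bij_betw_def inj_on_def)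
  define X where "X = {(l, a, b). l \<in> V - {k} \<and> a < n \<and> b < n \<and> (b = a \<or> l \<in> J \<and> b = Suc a)}"
  define U :: "('l \<times> nat \<times> nat \<Rightarrow> 'a) \<Rightarrow> 'l \<Rightarrow> nat \<Rightarrow> nat \<Rightarrow> 'a" where "U x l a b = x (l, a, b)" for x l a b
  define P where "P = (\<lambda>(i, j) x. form_entry n ((U x)(k := mat_unit i (j + 1 - ?r))) i j)"
  define T where "T = {(i, j). i + ?r \<le> j \<and> j < n}"
  have "X \<subseteq> V \<times> {..<n} \<times> {..<n}" "T \<subseteq> {..<n} \<times> {..<n}"
    by (auto simp: X_def T_def)
  then have fin: "finite X" "finite T"
    using finite_V by (auto intro: finite_subset)
  have affine: "P (i, j) (x((l, a, b) := s)) = P (i, j) (x((l, a, b) := 0)) +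
      s * form_entry n ((U x)(l := mat_unit a b, k := mat_unit i (j + 1 - ?r))) i j"
    if "(l, a, b) \<in> X" for i j l a b x s
  proof -
    let ?W = "(U x)(k := mat_unit i (j + 1 - ?r))"
    let ?Z = "\<lambda>p q. (x((l, a, b) := 0)) (l, p, q)"
    have lk: "l \<in> V" "l \<noteq> k"
      using that by (auto simp: X_def)
    have "(U (x((l, a, b) := s)))(k := mat_unit i (j + 1 - ?r)) = ?W(l := (\<lambda>p q. ?Z p q + s * mat_unit a b p q))"
      using lk by (intro ext) (auto simp: U_def mat_unit_def)
    moreover have "(U (x((l, a, b) := 0)))(k := mat_unit i (j + 1 - ?r)) = ?W(l := ?Z)"
      using lk by (intro ext) (auto simp: U_def)
    moreover have "(U x)(l := mat_unit a b, k := mat_unit i (j + 1 - ?r)) = ?W(l := mat_unit a b)"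
      using lk by (intro fun_upd_twist)
    ultimately show ?thesis
      unfolding P_def by (simp only: prod.case form_entry_linear[OF lk(1)])
  qed
  have shape: "bidiagonal_away J k (U x)" if "\<And>v. v \<notin> X \<Longrightarrow> x v = 0" for x
    unfolding bidiagonal_away_def U_def
  proof (intro ballI allI impI)
    fix l a b assume "x (l, a, b) \<noteq> 0"
    then have "(l, a, b) \<in> X"
      using that by blast
    then show "b = a \<or> l \<in> J \<and> b = Suc a"
      by (auto simp: X_def)
  qed
  have "\<exists>x. (\<forall>v. v \<notin> X \<longrightarrow> x v = 0) \<and> (\<forall>t\<in>T. P t x \<noteq> 0)"
  proof (rule common_nonzero_point[where ?x0.0 = "\<lambda>_. 0", OF fin])
    show "\<exists>\<beta>. \<forall>s. P t (x(v := s)) = P t (x(v := 0)) + s * \<beta>" if "v \<in> X" for t v x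
    proof (cases t; cases v)
      fix i j l a b assume "t = (i, j)" "v = (l, a, b)"
      with affine[of l a b i j x] that show ?thesis
        by blast
    qed
    show "\<exists>x. (\<forall>v. v \<notin> X \<longrightarrow> x v = 0) \<and> P t x \<noteq> 0" if tT: "t \<in> T" for t
    proof -
      obtain i j where t: "t = (i, j)"
        by (cases t)
      have ij: "i + ?r \<le> j" "j < n"
        using tT by (auto simp: t T_def)
      \<comment> \<open>The position map of the canonical route; it is strictly monotone because \<open>i < j - r + 1\<close>.\<close>
      define \<phi> where "\<phi> s = (if s = 0 then i else j - ?r + s)" for s
      have \<phi>_less: "\<phi> s < \<phi> s'" if "s < s'" for s s'
        using that ij unfolding \<phi>_def by (cases "s = 0") simp_all
      have inj: "inj_on \<phi> UNIV"
        by (rule linorder_inj_onI) (auto dest: \<phi>_less)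
      have \<phi>_lt_n: "\<phi> s < n" if "s \<le> ?r" for s
        using that ij unfolding \<phi>_def by (cases "s = 0") simp_all
      define x :: "'l \<times> nat \<times> nat \<Rightarrow> 'a" where
        "x = (\<lambda>(l, a, b). if l \<in> V - {k} then mat_unit (\<phi> (f l)) (\<phi> (g l)) a b else 0)"
      have "x (l, a, b) = 0" if "(l, a, b) \<notin> X" for l a b
      proof (rule ccontr)
        assume "x (l, a, b) \<noteq> 0"
        then have l: "l \<in> V - {k}" "a = \<phi> (f l)" "b = \<phi> (g l)"
          by (auto simp: x_def mat_unit_def split: if_splits)
        have le_r: "f l \<le> ?r" "g l \<le> ?r"
          using fg[of l] l(1) by auto
        have "a < n" "b < n"
          using l le_r \<phi>_lt_n by auto
        moreover have "b = a \<or> l \<in> J \<and> b = Suc a"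
        proof (cases "f l < g l")
          case True
          then have "l \<in> J" "g l = Suc (f l)"
            using l fg[of l] by (auto simp: J_def)
          then show ?thesis
            using f_pos[of l] l by (simp add: \<phi>_def)
        next
          case False
          then show ?thesis
            using l fg[of l] by auto
        qed
        ultimately show False
          using that l(1) by (simp add: X_def)
      qed
      moreover have "P t x = form_entry n (\<lambda>l. mat_unit ((\<phi> \<circ> f) l) ((\<phi> \<circ> g) l)) i j"
      proof -
        have "((U x)(k := mat_unit i (j + 1 - ?r))) l a b = mat_unit ((\<phi> \<circ> f) l) ((\<phi> \<circ> g) l) a b"
          if "l \<in> V" for l a b
          using that k gk ij rank by (auto simp: U_def x_def \<phi>_def Suc_diff_le)
        then show ?thesis
          unfolding t P_def prod.case by (rule form_entry_cong) (use ij in auto)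
      qed
      moreover have "\<dots> = route_coeff (\<phi> \<circ> f) (\<phi> \<circ> g) i j"
        using \<phi>_lt_n fg by (intro form_entry_mat_units) auto
      moreover have "route_coeff (\<phi> \<circ> f) (\<phi> \<circ> g) (\<phi> 0) (\<phi> ?r) = route_coeff f g 0 ?r"
        by (rule route_coeff_relabel[OF inj]) auto
      moreover have "\<phi> 0 = i" "\<phi> ?r = j"
        using rank ij by (auto simp: \<phi>_def)
      ultimately show ?thesis
        using ne by (intro exI[of _ x]) auto
    qed
    fix v assume v: "v \<in> X" and finK: "finite (UNIV :: 'a set)"
    obtain l a b where lab: "v = (l, a, b)"
      by (cases v)
    let ?rel = "{t \<in> T. \<exists>x s. (\<forall>v'. v' \<notin> X \<longrightarrow> x v' = 0) \<and> P t (x(v := s)) \<noteq> P t x}"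
    let ?D = "{(i, j). i + ?r \<le> j \<and> j < n \<and> (a = i \<or> j + 1 - ?r \<le> a \<and> a \<le> j)}"
    have "?rel \<subseteq> ?D"
    proof
      fix t assume "t \<in> ?rel"
      then obtain i j x s where t: "t = (i, j)" and ij: "i + ?r \<le> j" "j < n"
        and x: "\<And>v'. v' \<notin> X \<Longrightarrow> x v' = 0" and diff: "P (i, j) (x(v := s)) \<noteq> P (i, j) x"
        by (auto simp: T_def)
      let ?u = "(U x)(l := mat_unit a b)"
      have l: "l \<in> V - {k}" "b = a \<or> l \<in> J \<and> b = Suc a"
        using v by (auto simp: lab X_def)
      have ne: "form_entry n (?u(k := mat_unit i (j + 1 - ?r))) i j \<noteq> 0"
      proof
        assume zero: "form_entry n (?u(k := mat_unit i (j + 1 - ?r))) i j = 0"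
        have "P (i, j) (x(v := s')) = P (i, j) (x(v := 0))" for s'
          unfolding lab affine[OF v[unfolded lab], of i j x s'] zero by simp
        from this[of s] this[of "x v"] diff show False
          by (simp only: fun_upd_triv simp_thms)
      qed
      have bidiag: "bidiagonal_away J k ?u"
        unfolding bidiagonal_away_def
      proof (intro ballI allI impI)
        fix m p q assume m: "m \<in> V - {k}" "?u m p q \<noteq> 0"
        show "q = p \<or> m \<in> J \<and> q = Suc p"
        proof (cases "m = l")
          case True
          with m(2) have "mat_unit a b p q \<noteq> (0 :: 'a)"
            by simp
          then have "p = a" "q = b"
            by (auto simp: mat_unit_def)
          with l(2) True show ?thesis
            by simp
        next
          case False
          with m shape[of x, OF x] show ?thesis
            by (simp add: bidiagonal_away_def)
        qed
      qed
      have "i \<le> j + 1 - ?r" "i < n"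
        using ij by auto
      from bidiagonal_away_support(4)[OF bidiag J k(1) this ne]
      obtain f' g' where "\<forall>l\<in>V - {k}. ?u l (f' l) (g' l) \<noteq> 0 \<and>
          (i \<le> f' l \<and> f' l \<le> i \<or> j + 1 - ?r \<le> f' l \<and> f' l \<le> j)"
        by blast
      from bspec[OF this l(1)] have "mat_unit a b (f' l) (g' l) \<noteq> (0 :: 'a)"
        and pos: "f' l = i \<or> j + 1 - ?r \<le> f' l \<and> f' l \<le> j"
        by auto
      then have "f' l = a"
        by (auto simp: mat_unit_def)
      with pos ij show "t \<in> ?D"
        by (auto simp: t)
    qed
    moreover have "finite ?D"
      by (rule finite_subset[of _ "{..<n} \<times> {..<n}"]) auto
    ultimately have "card ?rel \<le> card ?D"
      by (intro card_mono)
    also have "\<dots> \<le> ?r * (n - ?r)"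
      by (rule card_positions_meeting[OF rank])
    also have "\<dots> < card (UNIV :: 'a set)"
      by (rule large[OF finK])
    finally show "card ?rel < card (UNIV :: 'a set)" .
  qed
  then obtain x where x: "\<And>v. v \<notin> X \<Longrightarrow> x v = 0" and pivots: "\<forall>t\<in>T. P t x \<noteq> 0"
    by blast
  have "form_entry n ((U x)(k := mat_unit i (j + 1 - ?r))) i j \<noteq> 0" if "i + ?r \<le> j" "j < n" for i j
    using pivots that by (auto simp: P_def T_def)
  with J k(1) shape[OF x] show thesis
    by (intro that)
qed

text \<open>
  Rows are cleared from the bottom upwards. A unit in row \<open>m\<close> of the unknown contributes to no row below \<open>m\<close>, and in row
  \<open>m\<close> the unit in column \<open>j + 1 - r\<close> contributes to column \<open>j\<close> alone, by the pivot. So row \<open>m\<close> of \<open>A\<close> is matched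
  by dividing by the pivots, and the error this makes in the rows above \<open>m\<close> is subtracted from \<open>A\<close>.
\<close>

lemma form_entry_surjective:
  assumes J: "J \<subseteq> V" "card J = jump_rank" "k \<in> J" and shape: "bidiagonal_away J k u"
    and pivot: "\<And>i j. \<lbrakk>i + jump_rank \<le> j; j < n\<rbrakk> \<Longrightarrow> form_entry n (u(k := mat_unit i (j + 1 - jump_rank))) i j \<noteq> 0"
    and A: "\<And>i j. \<lbrakk>i < n; j < n; \<not> i + jump_rank \<le> j\<rbrakk> \<Longrightarrow> A i j = 0"
  obtains N where "\<And>a b. b \<le> a \<Longrightarrow> N a b = 0" "\<And>i j. \<lbrakk>i < n; j < n\<rbrakk> \<Longrightarrow> form_entry n (u(k := N)) i j = A i j"
proof -
  let ?r = jump_rank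
  let ?L = "\<lambda>N. form_entry n (u(k := N))"
  have kV: "k \<in> V"
    using J by auto
  have "finite J"
    using J finite_V finite_subset by blast
  then have rank: "1 \<le> ?r"
    using J by (metis One_nat_def Suc_leI card_gt_0_iff empty_iff)
  have unit: "j + a + 1 = i + b + ?r \<and> i \<le> a \<and> b \<le> j"
    if "a < b" "i < n" "?L (mat_unit a b) i j \<noteq> 0" for a b i j
    using bidiagonal_away_support(1-3)[OF shape J _ that(2,3)] that(1) by auto
  have expand: "?L N i j = (\<Sum>a<n. \<Sum>b<n. N a b * ?L (mat_unit a b) i j)" if "i < n" for N i j
    by (rule form_entry_expand[OF kV that])
  have "\<exists>N. (\<forall>a b. b \<le> a \<longrightarrow> N a b = 0) \<and> (\<forall>i<n. \<forall>j<n. ?L N i j = A i j)"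
    if "\<And>i j. \<lbrakk>i < n; j < n; \<not> i + ?r \<le> j \<or> m \<le> i\<rbrakk> \<Longrightarrow> A i j = 0" for m A
    using that
  proof (induction m arbitrary: A)
    case 0
    have "?L (\<lambda>_ _. 0) i j = 0" if "i < n" for i j
      by (subst expand[OF that]) simp
    with 0 show ?case
      by (intro exI[of _ "\<lambda>_ _. 0"]) (simp del: fun_upd_apply)
  next
    case (Suc m)
    define C where "C j = ?L (mat_unit m (j + 1 - ?r)) m j" for j
    \<comment> \<open>Column \<open>b\<close> of the unknown serves column \<open>b + r - 1\<close> of \<open>A\<close>; the columns beyond \<open>n - r\<close> stay zero.\<close>
    define M where "M a b = (if a = m \<and> m < b \<and> b + ?r \<le> n then A m (b + ?r - 1) / C (b + ?r - 1) else 0)" for a b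
    have upper: "M a b = 0" if "b \<le> a" for a b
      using that by (auto simp: M_def)
    have M_support: "a = m" "a < b" if "M a b \<noteq> 0" for a b
      using that unfolding M_def by presburger+
    have zero: "?L M i j = 0" if "i < n" "\<not> i + ?r \<le> j \<or> m < i" for i j
    proof (subst expand[OF that(1)], intro sum.neutral ballI)
      fix a b
      show "M a b * ?L (mat_unit a b) i j = 0"
      proof (cases "M a b = 0")
        case False
        note ab = M_support[OF this]
        have "?L (mat_unit a b) i j = 0"
        proof (rule ccontr)
          assume "?L (mat_unit a b) i j \<noteq> 0"
          from unit[OF ab(2) that(1) this] ab that(2) show False
            by linarith
        qed
        then show ?thesis
          by simp
      qed simp
    qed
    have row: "?L M m j = A m j" if "m + ?r \<le> j" "j < n" for j
    proof -
      have b: "j + 1 - ?r < n" "m < j + 1 - ?r" "j + 1 - ?r + ?r = j + 1"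
        using that rank by linarith+
      have "M a b * ?L (mat_unit a b) m j = (if a = m \<and> b = j + 1 - ?r then A m j else 0)" for a b
      proof (cases "a = m \<and> b = j + 1 - ?r")
        case True
        have "C j \<noteq> 0"
          unfolding C_def by (rule pivot[OF that])
        moreover have "M a b = A m j / C j"
        proof -
          have "a = m" "m < b" "b + ?r \<le> n" "b + ?r - 1 = j"
            using True b that by simp_all
          then show ?thesis
            by (simp only: M_def simp_thms if_True)
        qed
        ultimately show ?thesis
          using True by (simp add: C_def)
      next
        case False
        have "M a b * ?L (mat_unit a b) m j = 0"
        proof (rule ccontr)
          assume "M a b * ?L (mat_unit a b) m j \<noteq> 0"
          then have ne: "M a b \<noteq> 0" "?L (mat_unit a b) m j \<noteq> 0"
            by simp_all
          note ab = M_support[OF ne(1)]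
          have "m < n"
            using that by linarith
          from unit[OF ab(2) this ne(2)] have "b = j + 1 - ?r"
            unfolding ab(1) by linarith
          with ab(1) False show False
            by simp
        qed
        then show ?thesis
          unfolding if_not_P[OF False] .
      qed
      moreover have "m < n"
        using that by linarith
      ultimately have "?L M m j = (\<Sum>a<n. \<Sum>b<n. if a = m \<and> b = j + 1 - ?r then A m j else 0)"
        by (simp only: expand[of m M j])
      also have "\<dots> = (\<Sum>a<n. if a = m then A m j else 0)"
        using b by (intro sum.cong refl) auto
      also have "\<dots> = A m j"
        using that by simp
      finally show ?thesis .
    qed
    have "\<exists>N. (\<forall>a b. b \<le> a \<longrightarrow> N a b = 0) \<and> (\<forall>i<n. \<forall>j<n. ?L N i j = A i j - ?L M i j)"
    proof (rule Suc.IH)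
      fix i j assume ij: "i < n" "j < n" "\<not> i + ?r \<le> j \<or> m \<le> i"
      show "A i j - ?L M i j = 0"
      proof (cases "i = m \<and> m + ?r \<le> j")
        case True
        with row ij show ?thesis
          by simp
      next
        case False
        with ij have "\<not> i + ?r \<le> j \<or> m < i"
          by auto
        then have "?L M i j = 0" "A i j = 0"
          using zero[OF ij(1)] Suc.prems[OF ij(1,2)] by auto
        then show ?thesis
          by (simp only: diff_self)
      qed
    qed
    then obtain N where N: "\<forall>a b. b \<le> a \<longrightarrow> N a b = 0" "\<forall>i<n. \<forall>j<n. ?L N i j = A i j - ?L M i j"
      by blast
    have "?L (\<lambda>a b. N a b + 1 * M a b) i j = A i j" if "i < n" "j < n" for i j
      unfolding form_entry_linear[OF kV] using N(2) that by simp
    moreover have "N a b + 1 * M a b = 0" if "b \<le> a" for a b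
      using N(1) upper that by simp
    ultimately show ?case
      by (intro exI[of _ "\<lambda>a b. N a b + 1 * M a b"]) blast
  qed
  from this[of n A] A obtain N where N: "\<forall>a b. b \<le> a \<longrightarrow> N a b = 0" "\<forall>i<n. \<forall>j<n. ?L N i j = A i j"
    by (auto simp: not_le)
  show thesis
  proof (rule that)
    show "N a b = 0" if "b \<le> a" for a b
      using N(1) that by simp
    show "?L N i j = A i j" if "i < n" "j < n" for i j
      using N(2) that by blast
  qed
qed

section \<open>The image of a multilinear form\<close>

lemma coeff_sum_nonzero:
  assumes "jump_rank = 0"
  shows "(\<Sum>w\<in>arrangements V. c w) \<noteq> 0"
proof -
  obtain f g where "\<And>l. l \<in> V \<Longrightarrow> f l \<le> g l \<and> g l \<le> Suc (f l) \<and> g l \<le> jump_rank"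
    and ne: "route_coeff f g 0 jump_rank \<noteq> 0" and "bij_betw f {l \<in> V. f l < g l} {..<jump_rank}"
    using canonical_route by blast
  then have zero: "f l = 0" "g l = 0" if "l \<in> V" for l
    using assms that by fastforce+
  have "is_route f g 0 w 0" if "set w \<subseteq> V" for w
    using that zero by (induction w) auto
  then have "route_coeff f g 0 0 = (\<Sum>w\<in>arrangements V. c w)"
    unfolding route_coeff_def by (intro sum.cong) (auto simp: arrangements_def)
  with ne assms show ?thesis
    by simp
qed

lemma form_entry_single_variable:
  assumes "k \<in> V" "i < n" "j < n"
  shows "form_entry n ((\<lambda>_ a b. of_bool (a = b))(k := A)) i j = (\<Sum>w\<in>arrangements V. c w) * A i j"
proof -
  have "path_sum n ((\<lambda>_ a b. of_bool (a = b))(k := A)) w i j = A i j" if "w \<in> arrangements V" for w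
    using path_sum_single_letter[of i n j w k "(\<lambda>_ a b. of_bool (a = b))(k := A)"] that assms
    by (auto simp: arrangements_def)
  then show ?thesis
    by (simp add: form_entry_def sum_distrib_right)
qed

theorem form_entry_image:
  assumes "V \<noteq> {}"
    and large: "\<lbrakk>1 \<le> jump_rank; finite (UNIV :: 'a set)\<rbrakk> \<Longrightarrow>
      jump_rank * (n - jump_rank) < card (UNIV :: 'a set)"
    and A: "\<And>i j. \<lbrakk>i < n; j < n; \<not> i + jump_rank \<le> j\<rbrakk> \<Longrightarrow> A i j = 0"
  obtains u where "\<And>l a b. \<lbrakk>l \<in> V; b < a; a < n\<rbrakk> \<Longrightarrow> u l a b = 0"
    "\<And>i j. \<lbrakk>i < n; j < n\<rbrakk> \<Longrightarrow> form_entry n u i j = A i j"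
proof (cases "jump_rank = 0")
  case True
  obtain k where k: "k \<in> V"
    using assms(1) by blast
  define s where "s = (\<Sum>w\<in>arrangements V. c w)"
  have s: "s \<noteq> 0"
    using coeff_sum_nonzero[OF True] by (simp add: s_def)
  let ?u = "(\<lambda>_ a b. of_bool (a = b))(k := (\<lambda>a b. A a b / s))"
  show thesis
  proof (rule that)
    show "?u l a b = 0" if "b < a" "a < n" for l a b
      using A[of a b] that True by auto
    show "form_entry n ?u i j = A i j" if "i < n" "j < n" for i j
      using form_entry_single_variable[OF k that] s by (simp add: s_def)
  qed
next
  case False
  then have rank: "1 \<le> jump_rank"
    by simp
  obtain J k u where J: "J \<subseteq> V" "card J = jump_rank" "k \<in> J" and shape: "bidiagonal_away J k u"
    and pivot: "\<And>i j. \<lbrakk>i + jump_rank \<le> j; j < n\<rbrakk> \<Longrightarrow> form_entry n (u(k := mat_unit i (j + 1 - jump_rank))) i j \<noteq> 0"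
    using nonzero_pivots[OF rank large[OF rank]] by blast
  obtain N where N: "\<And>a b. b \<le> a \<Longrightarrow> N a b = 0"
    "\<And>i j. \<lbrakk>i < n; j < n\<rbrakk> \<Longrightarrow> form_entry n (u(k := N)) i j = A i j"
    using form_entry_surjective[OF J shape, of n A] pivot A by blast
  show thesis
  proof (rule that)
    show "(u(k := N)) l a b = 0" if "l \<in> V" "b < a" for l a b
      using N(1)[of b a] shape that unfolding bidiagonal_away_def by (cases "l = k") force+
  qed (rule N(2))
qed

end

section \<open>Multilinear polynomials in the free algebra\<close>

lemma word_eval_carrier:
  assumes "\<And>l. l \<in> set w \<Longrightarrow> u l \<in> carrier_mat n n"
  shows "word_eval n u (Word w) \<in> carrier_mat n n"
  using assms by (induction w) (auto simp: word_eval_def intro!: mult_carrier_mat[of _ n n])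

lemma word_eval_entry:
  assumes "\<And>l. l \<in> set w \<Longrightarrow> u l \<in> carrier_mat n n" "i < n" "j < n"
  shows "word_eval n u (Word w) $$ (i, j) = path_sum n (\<lambda>l a b. u l $$ (a, b)) w i j"
  using assms
proof (induction w arbitrary: i)
  case Nil
  then show ?case
    by (simp add: word_eval_def)
next
  case (Cons l w)
  have ul: "u l \<in> carrier_mat n n"
    by (rule Cons.prems(1)) simp
  have cw: "word_eval n u (Word w) \<in> carrier_mat n n"
    by (rule word_eval_carrier) (use Cons.prems(1) in simp)
  have "word_eval n u (Word (l # w)) $$ (i, j) = (u l * word_eval n u (Word w)) $$ (i, j)"
    by (simp add: word_eval_def)
  also have "\<dots> = (\<Sum>a<n. u l $$ (i, a) * word_eval n u (Word w) $$ (a, j))"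
    using ul cw Cons.prems(2,3) by (simp add: scalar_prod_def atLeast0LessThan)
  also have "\<dots> = (\<Sum>a<n. u l $$ (i, a) * path_sum n (\<lambda>l a b. u l $$ (a, b)) w a j)"
  proof (rule sum.cong[OF refl])
    fix a assume "a \<in> {..<n}"
    then have "word_eval n u (Word w) $$ (a, j) = path_sum n (\<lambda>l a b. u l $$ (a, b)) w a j"
      using Cons.prems by (intro Cons.IH) auto
    then show "u l $$ (i, a) * word_eval n u (Word w) $$ (a, j) =
        u l $$ (i, a) * path_sum n (\<lambda>l a b. u l $$ (a, b)) w a j"
      by (rule arg_cong)
  qed
  finally show ?case
    by simp
qed

lemma prod_list_var:
  "(\<Prod>i\<leftarrow>xs. var (\<sigma> i)) = (Poly_Mapping.single (Word (map \<sigma> xs)) 1 :: 'a::field free_alg)"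
proof (induction xs)
  case Nil
  show ?case
    by (simp flip: zero_free_word_def single_one)
next
  case (Cons x xs)
  then show ?case
    by (simp add: var_def mult_single plus_free_word_def)
qed

lemma keys_multilinear:
  assumes "multilinear m p"
  shows "Poly_Mapping.keys p \<subseteq> Word ` arrangements {1..m}"
proof -
  obtain c where p: "p = (\<Sum>\<sigma> | \<sigma> permutes {1..m}. const (c \<sigma>) * (\<Prod>i\<leftarrow>[1..<Suc m]. var (\<sigma> i)))"
    using assms by (auto simp: multilinear_def)
  have "const (c \<sigma>) * (\<Prod>i\<leftarrow>[1..<Suc m]. var (\<sigma> i)) =
      Poly_Mapping.single (Word (map \<sigma> [1..<Suc m])) (c \<sigma>)" for \<sigma>
    unfolding prod_list_var const_def mult_single by simp
  then have "Poly_Mapping.keys p \<subseteq>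
      (\<Union>\<sigma>\<in>{\<sigma>. \<sigma> permutes {1..m}}. Poly_Mapping.keys (Poly_Mapping.single (Word (map \<sigma> [1..<Suc m])) (c \<sigma>)))"
    unfolding p by (simp only: keys_sum)
  also have "\<dots> \<subseteq> Word ` arrangements {1..m}"
  proof (intro UN_least)
    fix \<sigma> assume "\<sigma> \<in> {\<sigma>. \<sigma> permutes {1..m}}"
    then have \<sigma>: "\<sigma> permutes {1..m}"
      by simp
    have range: "set [1..<Suc m] = {1..m}"
      by auto
    have "distinct (map \<sigma> [1..<Suc m])"
      unfolding distinct_map range using permutes_inj_on[OF \<sigma>] by simp
    moreover have "set (map \<sigma> [1..<Suc m]) = {1..m}"
      unfolding set_map range by (rule permutes_image[OF \<sigma>])
    ultimately have "map \<sigma> [1..<Suc m] \<in> arrangements {1..m}"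
      by (simp only: arrangements_def mem_Collect_eq)
    moreover have "Poly_Mapping.keys (Poly_Mapping.single (Word (map \<sigma> [1..<Suc m])) (c \<sigma>)) \<subseteq>
        {Word (map \<sigma> [1..<Suc m])}"
      by (simp only: keys_single) simp
    ultimately show "Poly_Mapping.keys (Poly_Mapping.single (Word (map \<sigma> [1..<Suc m])) (c \<sigma>)) \<subseteq>
        Word ` arrangements {1..m}"
      by blast
  qed
  finally show ?thesis .
qed

text \<open>
  Links polynomials to \<open>multilinear_form\<close>: by \<open>keys_multilinear\<close> the sum over the support may be taken over all arrangements of
  the variables.
\<close>

lemma poly_eval_entry:
  assumes keys: "Poly_Mapping.keys p \<subseteq> Word ` arrangements {1..m}"
    and u: "\<And>l. l \<in> {1..m} \<Longrightarrow> u l \<in> carrier_mat n n" and ij: "i < n" "j < n"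
  shows "poly_eval n u p $$ (i, j) = (\<Sum>w\<in>arrangements {1..m}.
    Poly_Mapping.lookup p (Word w) * path_sum n (\<lambda>l a b. u l $$ (a, b)) w i j)"
proof -
  have "poly_eval n u p $$ (i, j) =
      (\<Sum>w\<in>Poly_Mapping.keys p. Poly_Mapping.lookup p w * word_eval n u w $$ (i, j))"
    using ij by (simp add: poly_eval_def)
  also have "\<dots> = (\<Sum>w\<in>Word ` arrangements {1..m}. Poly_Mapping.lookup p w * word_eval n u w $$ (i, j))"
  proof (rule sum.mono_neutral_left[OF _ keys])
    show "finite (Word ` arrangements {1..m})"
      by (intro finite_imageI finite_arrangements) simp
  qed (simp add: in_keys_iff)
  also have "\<dots> = (\<Sum>w\<in>arrangements {1..m}. Poly_Mapping.lookup p (Word w) * word_eval n u (Word w) $$ (i, j))"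
    by (subst sum.reindex) (auto simp: inj_on_def)
  also have "\<dots> = (\<Sum>w\<in>arrangements {1..m}.
      Poly_Mapping.lookup p (Word w) * path_sum n (\<lambda>l a b. u l $$ (a, b)) w i j)"
    by (intro sum.cong refl arg_cong2[where f = "(*)"] word_eval_entry ij u) (auto simp: arrangements_def)
  finally show ?thesis .
qed

theorem corollary1p1:
  fixes p :: "'k::field free_alg" and m n :: nat
  assumes "m \<ge> 1" and "n \<ge> 2"
    and "multilinear m p" and "p \<noteq> 0"
    and "finite (UNIV :: 'k set) \<Longrightarrow> real (card (UNIV :: 'k set)) > real n * (real n - 1) / 3"
  shows "\<exists>t::int. -1 \<le> t \<and> real_of_int t \<le> real m / 2 - 1 \<and> UT_image n m p = UT_level n t"
proof -
  have keys: "Poly_Mapping.keys p \<subseteq> Word ` arrangements {1..m}"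
    by (rule keys_multilinear[OF assms(3)])
  interpret multilinear_form "{1..m}" "\<lambda>w. Poly_Mapping.lookup p (Word w)"
  proof
    obtain v where "v \<in> Poly_Mapping.keys p"
      using \<open>p \<noteq> 0\<close> by fastforce
    with keys show "\<exists>w\<in>arrangements {1..m}. Poly_Mapping.lookup p (Word w) \<noteq> 0"
      by (auto simp: in_keys_iff)
  qed simp
  define t where "t = int jump_rank - 1"
  have entry: "poly_eval n u p $$ (i, j) = form_entry n (\<lambda>l a b. u l $$ (a, b)) i j"
    if "\<And>l. l \<in> {1..m} \<Longrightarrow> u l \<in> carrier_mat n n" "i < n" "j < n" for u i j
    unfolding form_entry_def by (rule poly_eval_entry[OF keys that])
  have poly_eval_carrier: "poly_eval n u p \<in> carrier_mat n n" for u
    by (simp add: poly_eval_def)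
  have "UT_image n m p \<subseteq> UT_level n t"
  proof
    fix A assume "A \<in> UT_image n m p"
    then obtain u where A: "A = poly_eval n u p" and u: "\<And>l. l \<in> {1..m} \<Longrightarrow> u l \<in> UT n"
      unfolding UT_image_def by blast
    have carrier: "u l \<in> carrier_mat n n" if "l \<in> {1..m}" for l
      using u[OF that] by (simp add: UT_def)
    have support: "i + jump_rank \<le> j" if "i < n" "j < n" "A $$ (i, j) \<noteq> 0" for i j
    proof (rule form_entry_nonzero_imp_distance)
      show "form_entry n (\<lambda>l a b. u l $$ (a, b)) i j \<noteq> 0"
        using that entry[OF carrier] by (simp add: A)
      show "u l $$ (a, b) = 0" if "l \<in> {1..m}" "b < a" "a < n" for l a b
        using u[OF that(1)] that by (auto simp: UT_def upper_triangular_def)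
    qed (rule that(1))
    have "A $$ (i, j) = 0" if "i < n" "j < n" "j < i \<or> int j - int i \<le> t" for i j
    proof (rule ccontr)
      assume "A $$ (i, j) \<noteq> 0"
      from support[OF that(1,2) this] that(3) show False
        by (auto simp: t_def)
    qed
    moreover have "A \<in> carrier_mat n n"
      unfolding A by (rule poly_eval_carrier)
    ultimately show "A \<in> UT_level n t"
      unfolding UT_level_def UT_def upper_triangular_def by auto
  qed
  moreover have "UT_level n t \<subseteq> UT_image n m p"
  proof
    fix A :: "'k mat" assume A: "A \<in> UT_level n t"
    have A_zero: "A $$ (i, j) = 0" if "i < n" "j < n" "\<not> i + jump_rank \<le> j" for i j
      using A that by (auto simp: UT_level_def t_def)
    have nonempty: "{1..m} \<noteq> {}"
      using \<open>m \<ge> 1\<close> by simp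
    have large: "jump_rank * (n - jump_rank) < card (UNIV :: 'k set)"
      if "1 \<le> jump_rank" "finite (UNIV :: 'k set)"
      using field_large_enough[OF that(2) \<open>n \<ge> 2\<close> that(1) assms(5)[OF that(2)]] .
    obtain u where upper: "\<And>l a b. \<lbrakk>l \<in> {1..m}; b < a; a < n\<rbrakk> \<Longrightarrow> u l a b = 0"
      and form_entry_u: "\<And>i j. \<lbrakk>i < n; j < n\<rbrakk> \<Longrightarrow> form_entry n u i j = A $$ (i, j)"
      using form_entry_image[where n = n and A = "\<lambda>i j. A $$ (i, j)", OF nonempty] large A_zero by blast
    define U where "U l = mat n n (\<lambda>(a, b). u l a b)" for l
    have U_carrier: "U l \<in> carrier_mat n n" for l
      by (simp add: U_def)
    have "A = poly_eval n U p"
    proof (rule eq_matI)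
      fix i j assume "i < dim_row (poly_eval n U p)" "j < dim_col (poly_eval n U p)"
      then have ij: "i < n" "j < n"
        by (simp_all add: poly_eval_def)
      have "A $$ (i, j) = form_entry n u i j"
        by (rule form_entry_u[OF ij, symmetric])
      also have "\<dots> = form_entry n (\<lambda>l a b. U l $$ (a, b)) i j"
        by (rule form_entry_cong) (simp_all add: U_def ij)
      also have "\<dots> = poly_eval n U p $$ (i, j)"
        by (rule entry[OF U_carrier ij, symmetric])
      finally show "A $$ (i, j) = poly_eval n U p $$ (i, j)" .
    qed (use A in \<open>auto simp: poly_eval_def UT_level_def UT_def\<close>)
    moreover have "U l \<in> UT n" if "l \<in> {1..m}" for l
      using upper[OF that] by (auto simp: U_def UT_def upper_triangular_def)
    ultimately show "A \<in> UT_image n m p"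
      unfolding UT_image_def by blast
  qed
  moreover have "real_of_int t \<le> real m / 2 - 1"
    using jump_rank_le_half by (simp add: t_def)
  moreover have "-1 \<le> t"
    by (simp add: t_def)
  ultimately show ?thesis
    by blast
qed

end
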